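(* Let $N\geq 3$, $f\in C^1(\mathbb{R})$, and let $u$ be a bounded radial stable solution of $-\Delta u=f(u)$ in $\mathbb{R}^N\setminus B_1$. Then the limit $u_\infty:=\lim_{r\to\infty}u(r)\in\mathbb{R}$ exists, and $u$ satisfies either $(L')$ or $(S')$ (exactly one of them), where: $(L')$ $N\geq 11$ and there exist $M>0$, $r_0\geq 1$ such that $$|u(r)-u_\infty|\geq M r^{-N/2+\sqrt{N-1}+2}\quad\forall r\geq r_0.$$ Moreover, $|\nabla u|\notin L^p(\mathbb{R}^N\setminus\overline{B_1})$ for every $1\leq p\leq\frac{N}{N/2-\sqrt{N-1}-1}$. In particular $|\nabla u|\notin L^2(\mathbb{R}^N\setminus\overline{B_1})$. $(S')$ There exists $M>0$ such that $$|u(r)-u_\infty|\leq M r^{-N/2-\sqrt{N-1}+2}\quad\forall r\geq 1.$$ Moreover, $|\nabla u|\in L^p(\mathbb{R}^N\setminus\overline{B_1})$ for every $\frac{N}{N/2+\sqrt{N-1}-1}<p\leq\infty$. In particular $|\nabla u|\in L^2(\mathbb{R}^N\setminus\overline{B_1})$.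
   Context: $B_1$ is the open unit ball of $\mathbb{R}^N$, so $\mathbb{R}^N\setminus B_1=\{x:|x|\geq 1\}$. Solutions are classical: $u\in C^2(\mathbb{R}^N\setminus B_1)$ (up to the boundary). A solution $u$ of $-\Delta u=f(u)$ in $\mathbb{R}^N\setminus B_1$ is called stable if $\int_{\mathbb{R}^N\setminus\overline{B_1}}\left(|\nabla v|^2-f'(u)v^2\right)dx\geq 0$ for every $v\in C^1(\mathbb{R}^N\setminus\overline{B_1})$ with compact support in $\mathbb{R}^N\setminus\overline{B_1}$. For radial $u$ one writes $u(r)$ for $u(x)$ with $r=|x|$. *)

theory Defs
  imports "HOL-Analysis.Analysis"
begin

definition exterior :: "'a::euclidean_space set"
  where "exterior = {x. 1 < norm x}"

definition closed_exterior :: "'a::euclidean_space set"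
  where "closed_exterior = {x. 1 \<le> norm x}"

text \<open>
  Derivatives are taken within the domain. At interior points this is the usual notion; at the
  boundary of a closed domain it expresses regularity up to the boundary. Derivatives within
  \<^const>\<open>exterior\<close> and \<^const>\<open>closed_exterior\<close> are unique, so that
  \<^const>\<open>frechet_derivative\<close> is meaningful on both.
\<close>

definition partial_on :: "'a::euclidean_space set \<Rightarrow> 'a \<Rightarrow> ('a \<Rightarrow> real) \<Rightarrow> 'a \<Rightarrow> real"
  where "partial_on S i u x = frechet_derivative u (at x within S) i"

definition gradient_on :: "'a::euclidean_space set \<Rightarrow> ('a \<Rightarrow> real) \<Rightarrow> 'a \<Rightarrow> 'a"
  where "gradient_on S u x = (\<Sum>i\<in>Basis. partial_on S i u x *\<^sub>R i)"

definition laplacian_on :: "'a::euclidean_space set \<Rightarrow> ('a \<Rightarrow> real) \<Rightarrow> 'a \<Rightarrow> real"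
  where "laplacian_on S u x = (\<Sum>i\<in>Basis. partial_on S i (partial_on S i u) x)"

definition C1_on :: "'a::euclidean_space set \<Rightarrow> ('a \<Rightarrow> real) \<Rightarrow> bool"
  where "C1_on S u \<longleftrightarrow>
    u differentiable_on S \<and> (\<forall>i\<in>Basis. continuous_on S (partial_on S i u))"

definition C2_on :: "'a::euclidean_space set \<Rightarrow> ('a \<Rightarrow> real) \<Rightarrow> bool"
  where "C2_on S u \<longleftrightarrow> C1_on S u \<and> (\<forall>i\<in>Basis. C1_on S (partial_on S i u))"

definition compact_support_in :: "'a::euclidean_space set \<Rightarrow> ('a \<Rightarrow> real) \<Rightarrow> bool"
  where "compact_support_in S v \<longleftrightarrow>
    compact (closure {x \<in> S. v x \<noteq> 0}) \<and> closure {x \<in> S. v x \<noteq> 0} \<subseteq> S"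

definition exterior_solution :: "(real \<Rightarrow> real) \<Rightarrow> ('a::euclidean_space \<Rightarrow> real) \<Rightarrow> bool"
  where "exterior_solution f u \<longleftrightarrow>
    C2_on closed_exterior u \<and>
    (\<forall>x\<in>closed_exterior. - laplacian_on closed_exterior u x = f (u x))"

text \<open>
  The integrand is continuous with compact support when \<open>f\<close> is \<open>C\<^sup>1\<close>, so the Bochner integral,
  which is 0 for non-integrable functions, is the true integral here.
\<close>

definition exterior_stable :: "(real \<Rightarrow> real) \<Rightarrow> ('a::euclidean_space \<Rightarrow> real) \<Rightarrow> bool"
  where "exterior_stable f u \<longleftrightarrow>
    (\<forall>v. C1_on exterior v \<and> compact_support_in exterior v \<longrightarrow>
      0 \<le> (LINT x|lebesgue_on exterior.
             (norm (gradient_on exterior v x))\<^sup>2 - deriv f (u x) * (v x)\<^sup>2))"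

text \<open>Membership in \<open>L\<^sup>p\<close> for an exponent \<open>1 \<le> p \<le> \<infinity>\<close>.\<close>

definition in_Lp :: "'a measure \<Rightarrow> ereal \<Rightarrow> ('a \<Rightarrow> real) \<Rightarrow> bool"
  where "in_Lp M p g \<longleftrightarrow>
    g \<in> borel_measurable M \<and>
    (if p = \<infinity> then (\<exists>C. AE x in M. \<bar>g x\<bar> \<le> C)
     else integrable M (\<lambda>x. \<bar>g x\<bar> powr real_of_ereal p))"

abbreviation gradient_in_Lp :: "ereal \<Rightarrow> ('a::euclidean_space \<Rightarrow> real) \<Rightarrow> bool"
  where "gradient_in_Lp p u \<equiv>
    in_Lp (lebesgue_on exterior) p (\<lambda>x. norm (gradient_on exterior u x))"

text \<open>In the two alternatives \<open>U\<close> is the radial profile of \<open>u\<close> and \<open>l\<close> its limit at infinity.\<close>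

definition slow_decay :: "(real ^ 'n \<Rightarrow> real) \<Rightarrow> (real \<Rightarrow> real) \<Rightarrow> real \<Rightarrow> bool"
  where "slow_decay u U l \<longleftrightarrow> (let N = real CARD('n) in
    CARD('n) \<ge> 11 \<and>
    (\<exists>M>0. \<exists>r0\<ge>1. \<forall>r\<ge>r0. \<bar>U r - l\<bar> \<ge> M * r powr (- N / 2 + sqrt (N - 1) + 2)) \<and>
    (\<forall>p::real. 1 \<le> p \<and> p \<le> N / (N / 2 - sqrt (N - 1) - 1) \<longrightarrow> \<not> gradient_in_Lp (ereal p) u) \<and>
    \<not> gradient_in_Lp 2 u)"

definition fast_decay :: "(real ^ 'n \<Rightarrow> real) \<Rightarrow> (real \<Rightarrow> real) \<Rightarrow> real \<Rightarrow> bool"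
  where "fast_decay u U l \<longleftrightarrow> (let N = real CARD('n) in
    (\<exists>M>0. \<forall>r\<ge>1. \<bar>U r - l\<bar> \<le> M * r powr (- N / 2 - sqrt (N - 1) + 2)) \<and>
    (\<forall>p::ereal. ereal (N / (N / 2 + sqrt (N - 1) - 1)) < p \<and> p \<le> \<infinity> \<longrightarrow> gradient_in_Lp p u) \<and>
    gradient_in_Lp 2 u)"

end

theory Submission
  imports Defs
begin

text \<open>
  Write \<open>W = U'\<close>, \<open>n = N - 1\<close>, \<open>p(r) = r\<^sup>n W(r)\<^sup>2\<close> and \<open>y = sqrt n\<close>. Differentiating the radial equation
  and testing stability with \<open>W(|x|) \<zeta>(|x|)\<close> gives the weighted Hardy inequality
  \<open>\<integral> p (\<zeta>'\<^sup>2 - y\<^sup>2 \<zeta>\<^sup>2/s\<^sup>2) ds \<ge> 0\<close> for Lipschitz \<open>\<zeta>\<close> with compact support in \<open>(1,\<infinity>)\<close>. Between two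
  zeros of \<open>W\<close> the choice \<open>\<zeta> = 1\<close> forces \<open>W = 0\<close>, so \<open>W\<close> eventually vanishes or has no zeros.
  In the latter case everything depends on whether \<open>\<integral> 1/p\<close> diverges at infinity. If it does,
  cutting off at infinity costs nothing, and \<open>\<zeta>\<close> equal to \<open>s\<^sup>y\<close> up to \<open>r\<close> and to a multiple of \<open>s\<^sup>\<alpha>\<close>,
  \<open>\<alpha> < y\<close>, beyond \<open>r\<close> bounds \<open>\<integral> p s\<^bsup>2\<alpha>-2\<^esup>\<close> over \<open>(r,\<infinity>)\<close> by a multiple of \<open>r\<^bsup>2\<alpha>-2y\<^esup>\<close>: fast decay.
  If it converges, then \<open>\<integral> p/s\<^sup>2\<close> diverges, so \<open>\<zeta>\<close> may first be held at 1 until its energy is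
  below \<open>-1\<close>; continuing it by a multiple of \<open>s\<^bsup>-y\<^esup>\<close> up to \<open>r\<close> and by the optimal cut-off beyond \<open>r\<close> bounds
  \<open>\<integral> 1/p\<close> over \<open>(r,\<infinity>)\<close> by a multiple of \<open>r\<^bsup>-2y\<^esup>\<close>: \<open>|W|\<close> is large in mean, hence slow decay.
\<close>

subsection \<open>Radial functions\<close>

text \<open>Polar coordinates: both measures give \<open>{..b}\<close> the volume of the ball of
  radius \<open>b\<close>, and closed half-lines form an intersection-stable generator of the Borel
  sets.\<close>

lemma distr_lborel_norm:
  "distr lborel borel (norm :: 'a::euclidean_space \<Rightarrow> real) =
    density lborel (\<lambda>r. ennreal (real DIM('a) * unit_ball_vol (real DIM('a)) * r ^ (DIM('a) - 1))
      * indicator {0..} r)" (is "?D = ?E")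
proof -
  define c where "c = unit_ball_vol (real DIM('a))"
  define n where "n = DIM('a)"
  have n: "n > 0" and c: "c \<ge> 0" by (simp_all add: n_def c_def)
  have D: "emeasure ?D {..b} = (if b < 0 then 0 else ennreal (c * b ^ n))" for b
  proof -
    have "emeasure ?D {..b} = emeasure lborel (cball 0 b :: 'a set)"
      by (subst emeasure_distr) (auto intro!: arg_cong[where f = "emeasure lborel"])
    also have "\<dots> = (if b < 0 then 0 else ennreal (c * b ^ n))"
      by (auto simp: emeasure_cball c_def n_def)
    finally show ?thesis .
  qed
  have E: "emeasure ?E {..b} = (if b < 0 then 0 else ennreal (c * b ^ n))" for b
  proof -
    have "emeasure ?E {..b} = (\<integral>\<^sup>+r. ennreal (real n * c * r ^ (n - 1)) * indicator {0..} r
        * indicator {..b} r \<partial>lborel)"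
      by (subst emeasure_density) (auto simp: c_def n_def)
    also have "\<dots> = (\<integral>\<^sup>+r. ennreal (real n * c * r ^ (n - 1)) * indicator {0..b} r \<partial>lborel)"
      by (intro nn_integral_cong) (auto split: split_indicator)
    also have "\<dots> = (if b < 0 then 0 else ennreal (c * b ^ n))"
    proof (cases "b < 0")
      case False
      have "(\<integral>\<^sup>+r. ennreal (real n * c * r ^ (n - 1)) * indicator {0..b} r \<partial>lborel)
          = ennreal (c * b ^ n - c * 0 ^ n)"
        using False n c by (intro nn_integral_FTC_Icc) (auto intro!: derivative_eq_intros)
      with False n show ?thesis by (simp add: zero_power)
    qed auto
    finally show ?thesis .
  qed
  show ?thesis
  proof (rule measure_eqI_generator_eq[where E = "range (\<lambda>b::real. {..b})" and \<Omega> = UNIV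
        and A = "\<lambda>i. {..real i}"])
    show "Int_stable (range (\<lambda>b::real. {..b}))"
      by (auto simp: Int_stable_def intro!: image_eqI[where x = "min _ _"])
    show "sets ?D = sigma_sets UNIV (range (\<lambda>b::real. {..b}))"
      "sets ?E = sigma_sets UNIV (range (\<lambda>b::real. {..b}))"
      by (simp_all add: borel_eq_atMost)
    show "(\<Union>i. {..real i}) = UNIV" by (auto simp: real_arch_simple)
    fix i show "emeasure ?D {..real i} \<noteq> \<infinity>" by (simp add: D)
  qed (use D E in auto)
qed

text \<open>As \<open>h\<close> vanishes on negative radii, the factor
  \<open>indicator {0..}\<close> of the density is absorbed and the plain weight
  \<open>r ^ (DIM('a) - 1)\<close> remains.\<close>

lemma radial_integral_eq:
  fixes h :: "real \<Rightarrow> real"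
  assumes [measurable]: "h \<in> borel_measurable borel" and h0: "\<And>r. r < 0 \<Longrightarrow> h r = 0"
  defines "c \<equiv> real DIM('a::euclidean_space) * unit_ball_vol (real DIM('a))"
  shows "(LINT x|lborel. h (norm (x::'a))) = c * (LINT r|lborel. r ^ (DIM('a) - 1) * h r)" (is ?I)
    and "integrable lborel (\<lambda>x::'a. h (norm x)) \<longleftrightarrow> integrable lborel (\<lambda>r. r ^ (DIM('a) - 1) * h r)"
proof -
  have cpos: "c > 0" by (simp add: c_def)
  let ?d = "\<lambda>r. c * r ^ (DIM('a) - 1) * indicator {0..} r"
  have eq: "distr lborel borel (norm :: 'a \<Rightarrow> real) = density lborel (\<lambda>r. ennreal (?d r))"
    unfolding distr_lborel_norm c_def
    by (intro arg_cong[where f = "density lborel"] ext) (auto split: split_indicator)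
  have nn: "AE r in lborel. 0 \<le> ?d r" using cpos by (auto split: split_indicator)
  have h': "?d r * h r = c * (r ^ (DIM('a) - 1) * h r)" for r
    using h0[of r] by (auto split: split_indicator)
  have "(LINT x|lborel. h (norm (x::'a))) = (LINT r|distr lborel borel (norm :: 'a \<Rightarrow> real). h r)"
    by (subst integral_distr) auto
  also have "\<dots> = (LINT r|lborel. ?d r *\<^sub>R h r)"
    unfolding eq using nn by (subst integral_density) auto
  also have "\<dots> = c * (LINT r|lborel. r ^ (DIM('a) - 1) * h r)"
    unfolding real_scaleR_def h' by (rule integral_mult_right_zero)
  finally show ?I .
  have "integrable lborel (\<lambda>x::'a. h (norm x)) \<longleftrightarrow> integrable (distr lborel borel (norm :: 'a \<Rightarrow> real)) h"
    by (subst integrable_distr_eq) auto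
  also have "\<dots> \<longleftrightarrow> integrable lborel (\<lambda>r. ?d r *\<^sub>R h r)"
    unfolding eq using nn by (subst integrable_density) auto
  also have "\<dots> \<longleftrightarrow> integrable lborel (\<lambda>r. r ^ (DIM('a) - 1) * h r)"
    unfolding real_scaleR_def h' using cpos by simp
  finally show "integrable lborel (\<lambda>x::'a. h (norm x)) \<longleftrightarrow>
      integrable lborel (\<lambda>r. r ^ (DIM('a) - 1) * h r)" .
qed

lemma open_exterior: "open (exterior :: 'a::euclidean_space set)"
  unfolding exterior_def by (intro open_Collect_less continuous_intros)

lemma has_derivative_radial:
  fixes x :: "'a::euclidean_space"
  assumes "open S" "x \<in> S" "x \<noteq> 0" "\<And>y. y \<in> S \<Longrightarrow> u y = U (norm y)"
    and "(U has_real_derivative d) (at (norm x))"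
  shows "(u has_derivative (\<lambda>h. d * (sgn x \<bullet> h))) (at x)"
proof -
  have "((\<lambda>y. U (norm y)) has_derivative (\<lambda>h. d * (sgn x \<bullet> h))) (at x)"
    using has_derivative_compose[OF has_derivative_norm[OF assms(3)]
        assms(5)[unfolded has_field_derivative_def]]
    by (simp add: inner_commute)
  then show ?thesis
    by (rule has_derivative_transform_within_open[OF _ assms(1,2)]) (simp add: assms(4))
qed

lemma partial_on_eqI:
  assumes "open T" "x \<in> T" "T \<subseteq> S" "(u has_derivative D) (at x)"
  shows "partial_on S i u x = D i"
proof -
  have "at x within S = at x" using assms(1-3) by (meson at_within_open_subset)
  then show ?thesis
    using frechet_derivative_at[OF assms(4)] by (simp add: partial_on_def)
qed

text \<open>\<open>S\<close> is left general because the equation uses derivatives within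
  \<open>closed_exterior\<close> and stability those within \<open>exterior\<close>; at points of
  the open exterior both are the full derivative.\<close>

lemma partial_radial:
  fixes x :: "'a::euclidean_space"
  assumes "\<And>y::'a. y \<in> exterior \<Longrightarrow> u y = U (norm y)" and "exterior \<subseteq> S" and "x \<in> exterior"
    and "(U has_real_derivative d) (at (norm x))"
  shows "partial_on S i u x = d * (sgn x \<bullet> i)"
proof -
  have "x \<noteq> 0" using assms(3) by (auto simp: exterior_def)
  then show ?thesis
    using has_derivative_radial[of exterior x u U d, OF open_exterior] assms
    by (intro partial_on_eqI[OF open_exterior]) auto
qed

lemma gradient_radial:
  fixes x :: "'a::euclidean_space"
  assumes "\<And>y::'a. y \<in> exterior \<Longrightarrow> u y = U (norm y)" "x \<in> exterior"
    and "(U has_real_derivative d) (at (norm x))"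
  shows "gradient_on exterior u x = d *\<^sub>R sgn x"
  unfolding gradient_on_def using partial_radial[OF assms(1) order_refl assms(2,3)]
  by (simp add: scaleR_scaleR[symmetric] scaleR_sum_right[symmetric] euclidean_representation
      del: scaleR_scaleR)

lemma norm_gradient_radial:
  fixes x :: "'a::euclidean_space"
  assumes "\<And>y::'a. y \<in> exterior \<Longrightarrow> u y = U (norm y)" "x \<in> exterior"
    and "(U has_real_derivative d) (at (norm x))"
  shows "norm (gradient_on exterior u x) = \<bar>d\<bar>"
proof -
  have "x \<noteq> 0" using assms(2) by (auto simp: exterior_def)
  then show ?thesis by (simp add: gradient_radial[OF assms] norm_sgn)
qed

text \<open>Makes radial test functions admissible in the definition of stability.\<close>

lemma C1_on_radial:
  assumes "\<And>y::'a::euclidean_space. y \<in> exterior \<Longrightarrow> u y = U (norm y)"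
    and "\<And>r. r > 1 \<Longrightarrow> (U has_real_derivative W r) (at r)" and "continuous_on {1<..} W"
  shows "C1_on exterior u"
  unfolding C1_on_def
proof (intro conjI ballI)
  show "u differentiable_on exterior"
  proof (rule differentiable_at_imp_differentiable_on)
    fix x :: 'a assume x: "x \<in> exterior"
    then have "x \<noteq> 0" by (auto simp: exterior_def)
    with x show "u differentiable at x"
      using has_derivative_radial[OF open_exterior x _ assms(1) assms(2)]
      by (auto simp: differentiable_def exterior_def)
  qed
  fix i :: 'a
  have "continuous_on exterior (\<lambda>x::'a. W (norm x) * (sgn x \<bullet> i))"
    unfolding sgn_div_norm
    by (intro continuous_intros continuous_on_compose2[OF assms(3)]) (auto simp: exterior_def)
  moreover have "partial_on exterior i u x = W (norm x) * (sgn x \<bullet> i)" if "x \<in> exterior" for x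
    using partial_radial[OF assms(1) order_refl that assms(2)] that by (simp add: exterior_def)
  ultimately show "continuous_on exterior (partial_on exterior i u)"
    using continuous_on_cong by (metis (no_types, lifting))
qed

subsection \<open>The radial equation\<close>

lemma exterior_subset_closed: "exterior \<subseteq> closed_exterior"
  by (auto simp: exterior_def closed_exterior_def)

text \<open>Applied first to \<open>u\<close> and then to its partial derivative in direction
  \<open>e\<close>: this is how the regularity of the profile is read off from that of
  \<open>u\<close>.\<close>

lemma has_derivative_along_ray:
  fixes g :: "'a::euclidean_space \<Rightarrow> real"
  assumes "g differentiable_on closed_exterior" "norm e = 1" "r > 1"
  shows "((\<lambda>t. g (t *\<^sub>R e)) has_real_derivative partial_on closed_exterior e g (r *\<^sub>R e)) (at r)"
proof -
  have x: "r *\<^sub>R e \<in> exterior" using assms(2,3) by (simp add: exterior_def)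
  have "at (r *\<^sub>R e) within closed_exterior = at (r *\<^sub>R e)"
    using at_within_open_subset[OF x open_exterior exterior_subset_closed] .
  with assms(1) x exterior_subset_closed have "g differentiable at (r *\<^sub>R e)"
    unfolding differentiable_on_def by fastforce
  then have D: "(g has_derivative frechet_derivative g (at (r *\<^sub>R e))) (at (r *\<^sub>R e))"
    by (simp add: frechet_derivative_works)
  have "((\<lambda>t. t *\<^sub>R e) has_derivative (\<lambda>t. t *\<^sub>R e)) (at r)"
    by (auto intro!: derivative_eq_intros)
  from has_derivative_compose[OF this D]
  have "((\<lambda>t. g (t *\<^sub>R e)) has_derivative
      (\<lambda>t. frechet_derivative g (at (r *\<^sub>R e)) (t *\<^sub>R e))) (at r)" .
  moreover have "frechet_derivative g (at (r *\<^sub>R e)) (t *\<^sub>R e)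
      = partial_on closed_exterior e g (r *\<^sub>R e) * t" for t
    using linear_cmul[OF has_derivative_linear[OF D], of t e]
      partial_on_eqI[OF open_exterior x exterior_subset_closed D, of e] by simp
  ultimately show ?thesis unfolding has_field_derivative_def by simp
qed

text \<open>Each partial derivative is the radial factor \<open>W r / r\<close> times the coordinate
  \<open>x \<bullet> i\<close>; the product rule and a summation over \<open>i\<close>, with
  \<open>sgn x \<bullet> x = r\<close>, do the rest.\<close>

lemma laplacian_radial:
  fixes x :: "'a::euclidean_space"
  assumes u: "\<And>y::'a. y \<in> exterior \<Longrightarrow> u y = U (norm y)" and S: "exterior \<subseteq> S"
    and U: "\<And>r. r > 1 \<Longrightarrow> (U has_real_derivative W r) (at r)"
    and W: "\<And>r. r > 1 \<Longrightarrow> (W has_real_derivative V r) (at r)" and x: "x \<in> exterior"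
  shows "laplacian_on S u x = V (norm x) + (real DIM('a) - 1) / norm x * W (norm x)"
proof -
  define r where "r = norm x"
  have r: "r > 1" and x0: "x \<noteq> 0" using x by (auto simp: exterior_def r_def)
  define K' where "K' = (V r * r - W r) / (r * r)"
  have K: "((\<lambda>t. W t / t) has_real_derivative K') (at r)"
    unfolding K'_def using r by (auto intro!: derivative_eq_intros W)
  have part: "partial_on S i (partial_on S i u) x = K' * (sgn x \<bullet> i) * (x \<bullet> i) + W r / r"
    if i: "i \<in> Basis" for i
  proof -
    have eq: "partial_on S i u y = W (norm y) / norm y * (y \<bullet> i)" if "y \<in> exterior" for y
      using partial_radial[OF u S that U] that
      by (simp add: exterior_def sgn_div_norm divide_inverse mult_ac)
    have "((\<lambda>y. W (norm y) / norm y) has_derivative (\<lambda>h. K' * (sgn x \<bullet> h))) (at x)"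
      by (rule has_derivative_radial[OF open_exterior x x0, where U = "\<lambda>t. W t / t"])
        (use K r_def in auto)
    then have "((\<lambda>y. W (norm y) / norm y * (y \<bullet> i)) has_derivative
        (\<lambda>h. W (norm x) / norm x * (h \<bullet> i) + K' * (sgn x \<bullet> h) * (x \<bullet> i))) (at x)"
      by (rule has_derivative_mult) (auto intro!: derivative_eq_intros)
    then have "(partial_on S i u has_derivative
        (\<lambda>h. W (norm x) / norm x * (h \<bullet> i) + K' * (sgn x \<bullet> h) * (x \<bullet> i))) (at x)"
      by (rule has_derivative_transform_within_open[OF _ open_exterior x]) (simp add: eq)
    from partial_on_eqI[OF open_exterior x S this, of i] i show ?thesis
      by (simp add: r_def)
  qed
  have "laplacian_on S u x = (\<Sum>i\<in>Basis. K' * ((sgn x \<bullet> i) * (x \<bullet> i))) + real DIM('a) * (W r / r)"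
    unfolding laplacian_on_def by (simp add: part sum.distrib mult.assoc)
  also have "(\<Sum>i\<in>Basis. K' * ((sgn x \<bullet> i) * (x \<bullet> i))) = K' * (sgn x \<bullet> x)"
    by (simp add: sum_distrib_left[symmetric] euclidean_inner[of "sgn x" x])
  also have "sgn x \<bullet> x = r"
    using x0 by (simp add: sgn_div_norm r_def dot_square_norm power2_eq_square)
  also have "K' * r + real DIM('a) * (W r / r) = V r + (real DIM('a) - 1) / r * W r"
    using r by (simp add: K'_def field_simps)
  finally show ?thesis by (simp add: r_def)
qed

text \<open>\<open>W\<close> and \<open>V\<close> are the first and second directional derivatives
  of \<open>u\<close> along one fixed ray, on which \<open>u\<close> coincides with its
  profile.\<close>

lemma radial_solution_ode:
  fixes u :: "'a::euclidean_space \<Rightarrow> real"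
  assumes sol: "exterior_solution f u" and u: "\<forall>x\<in>closed_exterior. u x = U (norm x)"
  obtains W V where
    "\<And>r. r > 1 \<Longrightarrow> (U has_real_derivative W r) (at r)"
    "\<And>r. r > 1 \<Longrightarrow> (W has_real_derivative V r) (at r)"
    "\<And>r. r > 1 \<Longrightarrow> V r + (real DIM('a) - 1) / r * W r = - f (U r)"
    "bounded (W ` {1..2})"
proof -
  obtain e :: 'a where e: "e \<in> Basis" by (meson nonempty_Basis ex_in_conv)
  then have ne: "norm e = 1" by simp
  define q where "q = partial_on closed_exterior e u"
  define W where "W r = q (r *\<^sub>R e)" for r
  define V where "V r = partial_on closed_exterior e q (r *\<^sub>R e)" for r
  have u': "u y = U (norm y)" if "y \<in> exterior" for y
    using u that exterior_subset_closed by blast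
  have C2: "C2_on closed_exterior u" using sol by (simp add: exterior_solution_def)
  have du: "u differentiable_on closed_exterior" and dq: "q differentiable_on closed_exterior"
    and cq: "continuous_on closed_exterior q"
    using C2 e by (auto simp: C2_on_def C1_on_def q_def)
  have U: "(U has_real_derivative W r) (at r)" if r: "r > 1" for r
    using has_derivative_along_ray[OF du ne r] unfolding W_def q_def
  proof (rule has_field_derivative_transform_within_open)
    show "open {1::real<..}" "r \<in> {1<..}" using r by auto
    fix t :: real assume "t \<in> {1<..}"
    then have "t *\<^sub>R e \<in> exterior" using e by (simp add: exterior_def)
    from u'[OF this] \<open>t \<in> {1<..}\<close> e show "u (t *\<^sub>R e) = U t" by simp
  qed
  have W: "(W has_real_derivative V r) (at r)" if r: "r > 1" for r
    using has_derivative_along_ray[OF dq ne r] unfolding W_def V_def .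
  have "V r + (real DIM('a) - 1) / r * W r = - f (U r)" if r: "r > 1" for r
  proof -
    have x: "r *\<^sub>R e \<in> exterior" using r e by (simp add: exterior_def)
    with sol exterior_subset_closed have "laplacian_on closed_exterior u (r *\<^sub>R e) = - f (u (r *\<^sub>R e))"
      unfolding exterior_solution_def by force
    with laplacian_radial[OF u' exterior_subset_closed U W x] u'[OF x] r e show ?thesis by simp
  qed
  moreover have "continuous_on {1..2} W"
    unfolding W_def using e
    by (intro continuous_on_compose2[OF cq] continuous_intros) (auto simp: closed_exterior_def)
  then have "bounded (W ` {1..2})"
    by (intro compact_imp_bounded compact_continuous_image) auto
  ultimately show ?thesis using that U W by blast
qed

text \<open>If \<open>W\<close> were large somewhere, it would stay large on an interval of length one, since
  \<open>(r\<^sup>n W)'\<close> is of order \<open>r\<^sup>n\<close>, and \<open>U\<close> would leave its range.\<close>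

lemma bounded_derivative:
  fixes U W V :: "real \<Rightarrow> real" and n :: nat
  assumes U: "\<And>r. r > 1 \<Longrightarrow> (U has_real_derivative W r) (at r)"
    and W: "\<And>r. r > 1 \<Longrightarrow> (W has_real_derivative V r) (at r)"
    and K: "\<And>r. r > 1 \<Longrightarrow> \<bar>V r + real n / r * W r\<bar> \<le> K"
    and B: "\<And>r. r > 1 \<Longrightarrow> \<bar>U r\<bar> \<le> B" and r: "r > 1"
  shows "\<bar>W r\<bar> \<le> 2 ^ n * (2 * B) + 2 ^ n * K"
proof -
  have K0: "K \<ge> 0" using K[of 2] by linarith
  have gen: "\<sigma> * W r \<le> 2 ^ n * (2 * B) + 2 ^ n * K" if \<sigma>: "\<sigma> = 1 \<or> \<sigma> = -1" for \<sigma> :: real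
  proof -
    \<comment> \<open>\<open>m\<close> bounds \<open>t ^ n * (\<sigma> * W t)\<close> from below on
      \<open>(r, r + 1]\<close>: the derivative of this function is \<open>\<sigma> * t ^ n\<close>
      times the quantity bounded by \<open>K\<close>, and \<open>t \<le> r + 1 \<le> 2 * r\<close>.
      The sign \<open>\<sigma>\<close> treats upper and lower bounds of \<open>W\<close>
      together.\<close>
    define m where "m = r ^ n * (\<sigma> * W r) - K * (2 * r) ^ n"
    have dg: "((\<lambda>t. t ^ n * (\<sigma> * W t)) has_real_derivative
        real n * \<xi> ^ (n - 1) * (\<sigma> * W \<xi>) + \<sigma> * V \<xi> * \<xi> ^ n) (at \<xi>)" if "r \<le> \<xi>" for \<xi>
      using that r by (auto intro!: derivative_eq_intros W)
    have low: "m \<le> t ^ n * (\<sigma> * W t)" if t: "r < t" "t \<le> r + 1" for t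
    proof -
      obtain \<xi> where \<xi>: "r < \<xi>" "\<xi> < t"
        and eq: "t ^ n * (\<sigma> * W t) - r ^ n * (\<sigma> * W r)
          = (t - r) * (real n * \<xi> ^ (n - 1) * (\<sigma> * W \<xi>) + \<sigma> * V \<xi> * \<xi> ^ n)"
        using MVT2[OF t(1), of "\<lambda>t. t ^ n * (\<sigma> * W t)"
            "\<lambda>\<xi>. real n * \<xi> ^ (n - 1) * (\<sigma> * W \<xi>) + \<sigma> * V \<xi> * \<xi> ^ n"] dg
        by auto
      have "real n * \<xi> ^ (n - 1) = real n / \<xi> * \<xi> ^ n"
        using \<xi> r by (cases n) (auto simp: field_simps)
      then have "real n * \<xi> ^ (n - 1) * (\<sigma> * W \<xi>) + \<sigma> * V \<xi> * \<xi> ^ n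
          = (\<sigma> * (V \<xi> + real n / \<xi> * W \<xi>)) * \<xi> ^ n"
        by (simp add: algebra_simps)
      also have "- K \<le> \<sigma> * (V \<xi> + real n / \<xi> * W \<xi>)"
        using K[of \<xi>] \<xi> r \<sigma> by (auto simp: abs_le_iff)
      then have "\<sigma> * (V \<xi> + real n / \<xi> * W \<xi>) * \<xi> ^ n \<ge> (- K) * \<xi> ^ n"
        using \<xi> r by (intro mult_right_mono) auto
      finally have "- (K * \<xi> ^ n) \<le> real n * \<xi> ^ (n - 1) * (\<sigma> * W \<xi>) + \<sigma> * V \<xi> * \<xi> ^ n" by simp
      moreover have "K * \<xi> ^ n \<le> K * (2 * r) ^ n"
        using \<xi> r t K0 by (intro mult_left_mono power_mono) auto
      ultimately have "- (K * (2 * r) ^ n) \<le> real n * \<xi> ^ (n - 1) * (\<sigma> * W \<xi>) + \<sigma> * V \<xi> * \<xi> ^ n"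
        by linarith
      then have "(t - r) * (- (K * (2 * r) ^ n))
          \<le> (t - r) * (real n * \<xi> ^ (n - 1) * (\<sigma> * W \<xi>) + \<sigma> * V \<xi> * \<xi> ^ n)"
        using t by (intro mult_left_mono) auto
      moreover have "(t - r) * (K * (2 * r) ^ n) \<le> 1 * (K * (2 * r) ^ n)"
        using t K0 r by (intro mult_right_mono) auto
      ultimately show ?thesis using eq by (simp add: m_def)
    qed
    have "m \<le> 2 * B * (2 * r) ^ n"
    proof (cases "m \<le> 0")
      case True
      have "0 \<le> B" using B[of 2] by linarith
      then have "0 \<le> 2 * B * (2 * r) ^ n" using r by simp
      with True show ?thesis by linarith
    next
      case False
      \<comment> \<open>At \<open>\<xi>\<close> the value of \<open>W\<close> is the increment of
        \<open>U\<close> over a unit interval, hence at most \<open>2 * B\<close> in modulus; by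
        \<open>low\<close> this limits \<open>m\<close>.\<close>
      obtain \<xi> where \<xi>: "r < \<xi>" "\<xi> < r + 1" and eq: "U (r + 1) - U r = (r + 1 - r) * W \<xi>"
        using MVT2[of r "r + 1" U W] U r by auto
      have "\<sigma> * W \<xi> \<le> 2 * B"
        using eq \<sigma> B[of r] B[of "r + 1"] r by (auto simp: abs_le_iff)
      have "m \<le> \<xi> ^ n * (\<sigma> * W \<xi>)" using low[of \<xi>] \<xi> by simp
      also have "\<dots> \<le> \<xi> ^ n * (2 * B)" using \<open>\<sigma> * W \<xi> \<le> 2 * B\<close> \<xi> r by (intro mult_left_mono) auto
      also have "\<dots> \<le> (2 * r) ^ n * (2 * B)"
        using \<xi> r B[of 2] by (intro mult_right_mono power_mono) auto
      finally show ?thesis by (simp add: mult_ac)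
    qed
    then have "(\<sigma> * W r) * r ^ n \<le> (2 ^ n * (2 * B) + 2 ^ n * K) * r ^ n"
      by (simp add: m_def power_mult_distrib algebra_simps)
    then show ?thesis using r by (simp add: mult_le_cancel_right)
  qed
  from gen[of 1] gen[of "-1"] show ?thesis by auto
qed

subsection \<open>Stability as a weighted Hardy inequality\<close>

lemma DERIV_continuous_on_greaterThan:
  fixes F F' :: "real \<Rightarrow> real"
  assumes "\<And>r. r > c \<Longrightarrow> (F has_real_derivative F' r) (at r)"
  shows "continuous_on {c<..} F"
  using assms by (intro DERIV_continuous_on[of _ F F']) (simp add: has_field_derivative_at_within)

text \<open>Test with \<open>v x = \<eta> (norm x)\<close>, whose support lies in the annulus
  \<open>a \<le> norm x \<le> b\<close>; polar coordinates contribute only a positive constant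
  factor.\<close>

lemma stable_radial:
  fixes u :: "'a::euclidean_space \<Rightarrow> real"
  assumes stable: "exterior_stable f u" and u: "\<forall>x\<in>closed_exterior. u x = U (norm x)"
    and f': "continuous_on UNIV (deriv f)" and U: "continuous_on {1<..} U"
    and \<eta>: "\<And>r. r > 1 \<Longrightarrow> (\<eta> has_real_derivative \<eta>' r) (at r)" "continuous_on {1<..} \<eta>'"
    and supp: "1 < a" "a < b" "\<And>r. r \<notin> {a<..<b} \<Longrightarrow> \<eta> r = 0"
  shows "0 \<le> integral {a..b} (\<lambda>r. r ^ (DIM('a) - 1) * ((\<eta>' r)\<^sup>2 - deriv f (U r) * (\<eta> r)\<^sup>2))"
proof -
  let ?v = "\<lambda>x::'a. \<eta> (norm x)"
  define h where "h r = indicator {a..b} r *\<^sub>R ((\<eta>' r)\<^sup>2 - deriv f (U r) * (\<eta> r)\<^sup>2)" for r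
  define c where "c = real DIM('a) * unit_ball_vol (real DIM('a))"
  have u': "u x = U (norm x)" if "x \<in> exterior" for x
    using u that exterior_subset_closed by blast
  have v1: "C1_on exterior ?v" by (rule C1_on_radial[of _ \<eta> \<eta>']) (use \<eta> in auto)
  have "closure {x \<in> exterior. ?v x \<noteq> 0} \<subseteq> {x. a \<le> norm x \<and> norm x \<le> b}"
  proof (rule closure_minimal)
    show "{x \<in> exterior. ?v x \<noteq> 0} \<subseteq> {x. a \<le> norm x \<and> norm x \<le> b}"
    proof safe
      fix x :: 'a assume "\<eta> (norm x) \<noteq> 0"
      then have "norm x \<in> {a<..<b}" using supp(3) by blast
      then show "a \<le> norm x" "norm x \<le> b" by auto
    qed
    show "closed {x::'a. a \<le> norm x \<and> norm x \<le> b}"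
      by (intro closed_Collect_conj closed_Collect_le continuous_intros)
  qed
  moreover have "bounded {x::'a. a \<le> norm x \<and> norm x \<le> b}"
    unfolding bounded_iff by blast
  ultimately have "bounded (closure {x \<in> exterior. ?v x \<noteq> 0})"
    "closure {x \<in> exterior. ?v x \<noteq> 0} \<subseteq> exterior"
    using supp(1) by (auto simp: exterior_def intro: bounded_subset)
  then have "compact_support_in exterior ?v"
    by (simp add: compact_support_in_def compact_eq_bounded_closed)
  with stable v1 have "0 \<le> (LINT x|lebesgue_on exterior.
      (norm (gradient_on exterior ?v x))\<^sup>2 - deriv f (u x) * (?v x)\<^sup>2)"
    unfolding exterior_stable_def by blast
  also have "\<dots> = (LINT x|lebesgue_on exterior. h (norm (x::'a)))"
  proof (rule Bochner_Integration.integral_cong[OF refl])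
    fix x :: 'a assume "x \<in> space (lebesgue_on exterior)"
    then have x: "x \<in> exterior" "norm x > 1" by (auto simp: exterior_def)
    \<comment> \<open>On the open complement of \<open>[a, b]\<close> the function
      \<open>\<eta>\<close> vanishes identically, hence so does its derivative, and the indicator in
      \<open>h\<close> changes nothing.\<close>
    have "\<eta>' (norm x) = 0" if "norm x \<notin> {a..b}"
    proof -
      have "(\<eta> has_real_derivative 0) (at (norm x))"
      proof (rule has_field_derivative_transform_within_open[where f = "\<lambda>_. 0" and S = "- {a..b}"])
        show "norm x \<in> - {a..b}" using that by simp
        show "0 = \<eta> r" if "r \<in> - {a..b}" for r using supp(3)[of r] that by auto
      qed auto
      with \<eta>(1)[OF x(2)] show ?thesis using DERIV_unique by blast
    qed
    moreover have "\<eta> (norm x) = 0" if "norm x \<notin> {a..b}" using supp(3) that by auto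
    ultimately show "(norm (gradient_on exterior ?v x))\<^sup>2 - deriv f (u x) * (?v x)\<^sup>2 = h (norm x)"
      using norm_gradient_radial[of ?v \<eta>, OF _ x(1) \<eta>(1)[OF x(2)]] u'[OF x(1)]
      by (auto simp: h_def split: split_indicator)
  qed
  also have "\<dots> = (LINT x|lebesgue. indicator exterior x *\<^sub>R h (norm (x::'a)))"
    by (rule integral_restrict_space) (simp add: open_exterior borel_open sets_completionI_sets)
  also have "\<dots> = (LINT x|lebesgue. h (norm (x::'a)))"
    using supp(1) by (intro Bochner_Integration.integral_cong) (auto simp: h_def exterior_def split: split_indicator)
  also have sub: "{a..b} \<subseteq> {1<..}" using supp(1) by auto
  have cont\<eta>: "continuous_on {a..b} \<eta>"
    using DERIV_continuous_on_greaterThan[OF \<eta>(1)] continuous_on_subset sub by blast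
  have cont: "continuous_on {a..b} (\<lambda>r. (\<eta>' r)\<^sup>2 - deriv f (U r) * (\<eta> r)\<^sup>2)"
    by (intro continuous_intros cont\<eta> continuous_on_compose2[OF f']
        continuous_on_subset[OF \<eta>(2) sub] continuous_on_subset[OF U sub]) auto
  then have [measurable]: "h \<in> borel_measurable borel"
    unfolding h_def by (intro borel_measurable_continuous_on_indicator) auto
  have "(LINT x|lebesgue. h (norm (x::'a))) = (LINT x|lborel. h (norm (x::'a)))"
    by (rule integral_completion) measurable
  also have "\<dots> = c * (LINT r|lborel. r ^ (DIM('a) - 1) * h r)"
    unfolding c_def using supp(1) by (intro radial_integral_eq) (measurable, simp add: h_def)
  also have "(LINT r|lborel. r ^ (DIM('a) - 1) * h r)
      = (LINT r:{a..b}|lborel. r ^ (DIM('a) - 1) * ((\<eta>' r)\<^sup>2 - deriv f (U r) * (\<eta> r)\<^sup>2))"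
    unfolding set_lebesgue_integral_def
    by (intro Bochner_Integration.integral_cong) (auto simp: h_def)
  also have "\<dots> = integral {a..b} (\<lambda>r. r ^ (DIM('a) - 1) * ((\<eta>' r)\<^sup>2 - deriv f (U r) * (\<eta> r)\<^sup>2))"
    by (intro set_borel_integral_eq_integral borel_integrable_atLeastAtMost' continuous_intros cont)
  finally have "0 \<le> c * integral {a..b}
      (\<lambda>r. r ^ (DIM('a) - 1) * ((\<eta>' r)\<^sup>2 - deriv f (U r) * (\<eta> r)\<^sup>2))" .
  moreover have "c > 0" by (simp add: c_def)
  ultimately show ?thesis by (simp add: zero_le_mult_iff)
qed

text \<open>Substituting \<open>\<eta> = W \<zeta>\<close>, where \<open>W = U'\<close> solves the equation differentiated in \<open>r\<close>.\<close>

lemma stable_weighted: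
  fixes U W V f f' :: "real \<Rightarrow> real" and n :: nat
  assumes stable: "\<And>\<eta> \<eta>'. (\<And>r. r > 1 \<Longrightarrow> (\<eta> has_real_derivative \<eta>' r) (at r)) \<Longrightarrow>
        continuous_on {1<..} \<eta>' \<Longrightarrow> (\<And>r. r \<notin> {a<..<b} \<Longrightarrow> \<eta> r = 0) \<Longrightarrow>
        0 \<le> integral {a..b} (\<lambda>r. r ^ n * ((\<eta>' r)\<^sup>2 - f' (U r) * (\<eta> r)\<^sup>2))"
    and f: "\<And>x. (f has_real_derivative f' x) (at x)" and f': "continuous_on UNIV f'"
    and U: "\<And>r. r > 1 \<Longrightarrow> (U has_real_derivative W r) (at r)"
    and W: "\<And>r. r > 1 \<Longrightarrow> (W has_real_derivative V r) (at r)"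
    and ode: "\<And>r. r > 1 \<Longrightarrow> V r + real n / r * W r = - f (U r)"
    and z: "\<And>r. r > 1 \<Longrightarrow> (z has_real_derivative z' r) (at r)" "continuous_on {1<..} z'"
    and supp: "1 < a" "a < b" "\<And>r. r \<notin> {a<..<b} \<Longrightarrow> z r = 0"
  shows "0 \<le> integral {a..b} (\<lambda>r. r ^ n * (W r)\<^sup>2 * (z' r)\<^sup>2 - real n * (r ^ n * (W r)\<^sup>2) / r\<^sup>2 * (z r)\<^sup>2)"
proof -
  \<comment> \<open>By the equation \<open>V = - f (U) - n / r * W\<close> is differentiable,
    although \<open>u\<close> is only assumed to be twice differentiable; \<open>V'\<close> is the
    derivative of the right-hand side.\<close>
  define V' where "V' r = - (f' (U r) * W r) - (real n / r * V r - real n / r\<^sup>2 * W r)" for r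
  have V: "(V has_real_derivative V' r) (at r)" if r: "r > 1" for r
  proof (rule has_field_derivative_transform_within_open)
    show "((\<lambda>r. - f (U r) - real n / r * W r) has_real_derivative V' r) (at r)"
      unfolding V'_def using r
      by (auto intro!: derivative_eq_intros U W DERIV_chain2[OF f] simp: power2_eq_square field_simps)
    show "open {1::real<..}" "r \<in> {1<..}" using r by auto
    show "- f (U t) - real n / t * W t = V t" if "t \<in> {1<..}" for t
      using ode[of t] that by simp
  qed
  have cont: "continuous_on {1<..} W" "continuous_on {1<..} V" "continuous_on {1<..} U" "continuous_on {1<..} z"
    using DERIV_continuous_on_greaterThan W V U z(1) by blast+
  let ?A = "\<lambda>r. r ^ n * ((V r * z r + W r * z' r)\<^sup>2 - f' (U r) * (W r * z r)\<^sup>2)"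
  let ?B = "\<lambda>r. r ^ n * (W r)\<^sup>2 * (z' r)\<^sup>2 - real n * (r ^ n * (W r)\<^sup>2) / r\<^sup>2 * (z r)\<^sup>2"
  let ?G = "\<lambda>r. r ^ n * V r * W r * (z r)\<^sup>2"
  have "0 \<le> integral {a..b} ?A"
  proof (rule stable)
    show "((\<lambda>r. W r * z r) has_real_derivative V r * z r + W r * z' r) (at r)" if "r > 1" for r
      using that by (auto intro!: derivative_eq_intros W z)
    show "continuous_on {1<..} (\<lambda>r. V r * z r + W r * z' r)"
      by (intro continuous_intros cont z)
  qed (use supp(3) in auto)
  also have "integral {a..b} ?A = integral {a..b} ?B"
  proof -
    have sub: "{a..b} \<subseteq> {1<..}" using supp(1) by auto
    have iA: "?A integrable_on {a..b}"
      by (intro integrable_continuous_interval continuous_intros continuous_on_compose2[OF f']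
        continuous_on_subset[OF cont(1) sub] continuous_on_subset[OF cont(2) sub] 
        continuous_on_subset[OF cont(3) sub] continuous_on_subset[OF cont(4) sub]
        continuous_on_subset[OF z(2) sub]) auto
    \<comment> \<open>Integration by parts in closed form: once \<open>V'\<close> is inserted,
      \<open>?A - ?B\<close> is the derivative of \<open>?G\<close>, which vanishes with
      \<open>z\<close> at both ends. The term with \<open>f'\<close> cancels, and the summand
      \<open>n / r^2 * W\<close> of \<open>V'\<close> leaves the Hardy term.\<close>
    have "((\<lambda>r. ?A r - ?B r) has_integral ?G b - ?G a) {a..b}"
    proof (rule fundamental_theorem_of_calculus)
      fix r assume "r \<in> {a..b}"
      then have r: "r > 1" using supp(1) by simp
      \<comment> \<open>For \<open>n = 0\<close> both sides are 0, so the truncated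
        \<open>n - 1\<close> is harmless.\<close>
      have n: "real n * r ^ (n - 1) = real n / r * r ^ n" using r by (cases n) auto
      have "(?G has_real_derivative real n * r ^ (n - 1) * (V r * W r * (z r)\<^sup>2)
          + r ^ n * (V' r * W r * (z r)\<^sup>2 + (V r)\<^sup>2 * (z r)\<^sup>2 + 2 * (V r * W r * z r * z' r))) (at r)"
        using r by (auto intro!: derivative_eq_intros V W z) (simp add: power2_eq_square algebra_simps)
      also have "real n * r ^ (n - 1) * (V r * W r * (z r)\<^sup>2)
          + r ^ n * (V' r * W r * (z r)\<^sup>2 + (V r)\<^sup>2 * (z r)\<^sup>2 + 2 * (V r * W r * z r * z' r)) = ?A r - ?B r"
        unfolding n V'_def divide_inverse power2_eq_square by (simp add: algebra_simps)
      finally have "(?G has_real_derivative ?A r - ?B r) (at r)" .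
      then show "(?G has_vector_derivative ?A r - ?B r) (at r within {a..b})"
        by (simp add: has_real_derivative_iff_has_vector_derivative has_vector_derivative_at_within)
    qed (use supp in auto)
    moreover have "?G b = 0" "?G a = 0" using supp(3)[of a] supp(3)[of b] by auto
    ultimately have AB: "((\<lambda>r. ?A r - ?B r) has_integral 0) {a..b}" by simp
    have "(?B has_integral integral {a..b} ?A - 0) {a..b}"
      using has_integral_diff[OF integrable_integral[OF iA] AB] by simp
    from integral_unique[OF this] show ?thesis by simp
  qed
  finally show ?thesis .
qed

text \<open>Steklov averages \<open>s \<mapsto> (\<integral>\<^bsub>s\<^esub>\<^bsup>s+h\<^esup> Z) / h\<close> of a Lipschitz function are \<open>C\<^sup>1\<close>; as \<open>h \<rightarrow> 0\<close> they and
  their (uniformly bounded) derivatives converge off a finite set.\<close>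

lemma nonneg_form_lipschitz:
  fixes p q z g :: "real \<Rightarrow> real"
  assumes smooth: "\<And>z z' a b. 1 < a \<Longrightarrow> a < b \<Longrightarrow>
      (\<And>r. r > 1 \<Longrightarrow> (z has_real_derivative z' r) (at r)) \<Longrightarrow> continuous_on {1<..} z' \<Longrightarrow>
      (\<And>r. r \<notin> {a<..<b} \<Longrightarrow> z r = 0) \<Longrightarrow>
      0 \<le> integral {a..b} (\<lambda>r. p r * (z' r)\<^sup>2 - q r * (z r)\<^sup>2)"
    and pq: "continuous_on {1<..} p" "continuous_on {1<..} q"
    and ab: "1 < a" "a < b" and z: "continuous_on {a..b} z" "z a = 0" "z b = 0"
    and g: "finite S" "\<And>r. r \<in> {a<..<b} - S \<Longrightarrow> (z has_real_derivative g r) (at r)"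
    and L: "0 \<le> L" "\<And>r. r \<in> {a<..<b} - S \<Longrightarrow> \<bar>g r\<bar> \<le> L"
    and I: "((\<lambda>r. p r * (g r)\<^sup>2 - q r * (z r)\<^sup>2) has_integral e) {a..b}"
  shows "0 \<le> e"
proof -
  have lip1: "\<bar>z t - z s\<bar> \<le> L * (t - s)" if st: "a \<le> s" "s \<le> t" "t \<le> b" for s t
  proof -
    have "(g has_integral (z t - z s)) {s..t}"
      by (rule fundamental_theorem_of_calculus_interior_strong[OF g(1)])
        (use st g(2) in \<open>auto simp: has_real_derivative_iff_has_vector_derivative[symmetric]
           intro!: continuous_on_subset[OF z(1)]\<close>)
    then have "norm (z t - z s) \<le> L * measure lborel (cbox s t)"
      by (intro has_integral_bound_spike_finite[of L "S \<union> {a, b}" g]) (use L g(1) st in auto)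
    then show ?thesis using st by simp
  qed
  \<comment> \<open>Since \<open>z\<close> vanishes at \<open>a\<close> and \<open>b\<close>, this
    extends it by zero to the whole line, with the same Lipschitz constant.\<close>
  define Z where "Z s = z (max a (min b s))" for s
  have Zout: "Z s = 0" if "s \<notin> {a<..<b}" for s
    using that z ab by (cases "s \<le> a") (auto simp: Z_def)
  have Zin: "Z s = z s" if "s \<in> {a..b}" for s using that by (auto simp: Z_def)
  have lip: "\<bar>Z t - Z s\<bar> \<le> L * \<bar>t - s\<bar>" for s t
  proof -
    have *: "\<bar>Z t - Z s\<bar> \<le> L * (t - s)" if "s \<le> t" for s t
    proof -
      have "\<bar>Z t - Z s\<bar> \<le> L * (max a (min b t) - max a (min b s))"
        unfolding Z_def using ab that by (intro lip1) auto
      also have "\<dots> \<le> L * (t - s)" using that L(1) by (intro mult_left_mono) auto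
      finally show ?thesis .
    qed
    from *[of s t] *[of t s] show ?thesis by (cases "s \<le> t") auto
  qed
  have contZ: "continuous_on T Z" for T
    unfolding Z_def using ab
    by (intro continuous_on_compose2[OF z(1)] continuous_intros) auto
  define M where "M = L * (b - a)"
  have ZM: "\<bar>Z s\<bar> \<le> M" for s
  proof (cases "s \<in> {a..b}")
    case True
    then have "\<bar>Z s\<bar> \<le> L * (s - a)" using lip1[of a s] z(2) Zin[of s] by auto
    also have "\<dots> \<le> M" unfolding M_def using True L(1) by (intro mult_left_mono) auto
    finally show ?thesis .
  qed (use Zout[of s] L ab in \<open>auto simp: M_def\<close>)
  define F where "F s = integral {0..s} Z" for s
  have F: "(F has_real_derivative Z s) (at s)" if "s > 0" for s
    using integral_has_real_derivative[of 0 "s + 1" Z s] contZ that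
    unfolding F_def by (simp add: at_within_Icc_at)
  have F0: "F s = 0" if "s \<le> a" for s
    unfolding F_def using that by (intro integral_unique has_integral_is_0) (auto intro: Zout)
  \<comment> \<open>With \<open>h n \<le> (a - 1) / 2\<close> the averages \<open>zn n\<close>
    vanish outside \<open>(a', b)\<close>, where \<open>a' > 1\<close>, so that
    \<open>smooth\<close> applies to them.\<close>
  define h where "h n = (a - 1) / 2 / real (Suc n)" for n
  have h: "h n > 0" "h n \<le> (a - 1) / 2" for n
    using ab divide_left_mono[of 1 "real (Suc n)" "(a - 1) / 2"] by (auto simp: h_def)
  have h0: "h \<longlonglongrightarrow> 0"
    unfolding h_def by (rule LIMSEQ_Suc) (rule lim_const_over_n)
  define zn where "zn n s = (F (s + h n) - F s) / h n" for n s
  define zn' where "zn' n s = (Z (s + h n) - Z s) / h n" for n s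
  define a' where "a' = (1 + a) / 2"
  have a': "1 < a'" "a' < a" using ab by (auto simp: a'_def)
  \<comment> \<open>Each average is a value of \<open>Z\<close> at a nearby point. This yields the
    bound \<open>M\<close>, the vanishing to the right of \<open>b\<close> and, with
    \<open>lip\<close>, the convergence to \<open>Z\<close>.\<close>
  have mvt: "\<exists>\<xi>. s < \<xi> \<and> \<xi> < s + h n \<and> zn n s = Z \<xi>" if s: "s > 0" for n s
  proof -
    have "\<exists>\<xi>. s < \<xi> \<and> \<xi> < s + h n \<and> F (s + h n) - F s = (s + h n - s) * Z \<xi>"
      by (rule MVT2) (use F s h[of n] in auto)
    then show ?thesis using h(1)[of n] by (auto simp: zn_def)
  qed
  let ?f = "\<lambda>n r. p r * (zn' n r)\<^sup>2 - q r * (zn n r)\<^sup>2"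
  let ?G = "\<lambda>r. if r \<in> {a<..<b} then g r else 0"
  let ?S = "insert a (insert b S)"
  have dzn: "(zn n has_real_derivative zn' n r) (at r)" if "r > 1" for n r
    unfolding zn_def zn'_def using that h(1)[of n]
    by (auto intro!: derivative_eq_intros F DERIV_chain2[OF F, of "\<lambda>x. x + h n"])
  have czn': "continuous_on T (zn' n)" for n T
    unfolding zn'_def using h(1)[of n]
    by (intro continuous_intros continuous_on_compose2[OF contZ[of UNIV]]) auto
  have pos: "0 \<le> integral {a'..b} (?f n)" for n
  proof (rule smooth)
    show "zn n r = 0" if r: "r \<notin> {a'<..<b}" for r
    proof (cases "r \<le> a'")
      case True
      then have "r + h n \<le> a" "r \<le> a" using h(2)[of n] a' by (auto simp: a'_def field_simps)
      then show ?thesis by (simp add: zn_def F0)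
    next
      case False
      with r a' have "b \<le> r" "r > 0" by auto
      from mvt[OF this(2), of n] obtain \<xi> where "r < \<xi>" "zn n r = Z \<xi>" by blast
      with Zout[of \<xi>] \<open>b \<le> r\<close> show ?thesis by simp
    qed
  qed (use a' ab dzn czn' in auto)
  have znbd: "\<bar>zn n r\<bar> \<le> M" if "r > 1" for n r
  proof -
    have "r > 0" using that by simp
    from mvt[OF this, of n] obtain \<xi> where "zn n r = Z \<xi>" by blast
    then show ?thesis using ZM by simp
  qed
  have zn'bd: "\<bar>zn' n r\<bar> \<le> L" for n r
    using lip[of "r + h n" r] h(1)[of n] by (simp add: zn'_def divide_le_eq abs_divide)
  have sub: "{a'..b} \<subseteq> {1<..}" using a' by auto
  have cp: "continuous_on {a'..b} p" "continuous_on {a'..b} q"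
    using pq sub continuous_on_subset by blast+
  have limzn: "(\<lambda>n. zn n r) \<longlonglongrightarrow> Z r" if r: "r > 1" for r
  proof -
    have "\<bar>zn n r - Z r\<bar> \<le> L * h n" for n
    proof -
      obtain \<xi> where "r < \<xi>" "\<xi> < r + h n" "zn n r = Z \<xi>" using mvt[of r n] r by auto
      with lip[of \<xi> r] have "\<bar>zn n r - Z r\<bar> \<le> L * \<bar>\<xi> - r\<bar>" by simp
      also have "\<dots> \<le> L * h n" using L(1) \<open>r < \<xi>\<close> \<open>\<xi> < r + h n\<close> by (intro mult_left_mono) auto
      finally show ?thesis .
    qed
    then have "\<forall>\<^sub>F n in sequentially. norm (zn n r - Z r) \<le> L * h n"
      by simp
    moreover have "(\<lambda>n. L * h n) \<longlonglongrightarrow> 0"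
      using tendsto_mult_left[OF h0, of L] by simp
    ultimately have "(\<lambda>n. zn n r - Z r) \<longlonglongrightarrow> 0"
      by (rule Lim_null_comparison)
    then show ?thesis by (rule LIM_zero_cancel)
  qed
  have limzn': "(\<lambda>n. zn' n r) \<longlonglongrightarrow> ?G r" if r: "r \<notin> ?S" for r
  proof -
    have "(Z has_real_derivative ?G r) (at r)"
    proof (cases "r \<in> {a<..<b}")
      case True
      then have "(z has_real_derivative g r) (at r)" using g(2) r by auto
      then show ?thesis
        using True Zin
        by (auto elim!: has_field_derivative_transform_within_open[where S = "{a<..<b}"])
    next
      case False
      with r have "r \<in> {..<a} \<union> {b<..}" by auto
      moreover have "open ({..<a} \<union> {b<..})" by auto
      ultimately have "(Z has_real_derivative 0) (at r)"
        using has_field_derivative_transform_within_open[of "\<lambda>_. 0" 0 r "{..<a} \<union> {b<..}" Z] Zout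
        by fastforce
      with False show ?thesis by auto
    qed
    then have "((\<lambda>h. (Z (r + h) - Z r) / h) \<longlongrightarrow> ?G r) (at 0)" by (simp add: DERIV_def)
    moreover have "filterlim h (at 0) sequentially"
      unfolding filterlim_at using h0 h(1) by (simp add: less_le)
    ultimately show ?thesis unfolding zn'_def by (rule filterlim_compose)
  qed
  \<comment> \<open>On the finite set where \<open>Z\<close> may have no derivative the integrands
    are set to 0, so that convergence holds at every point; \<open>L\<close> and \<open>M\<close>
    supply the majorant.\<close>
  have "(\<lambda>n. integral {a'..b} (\<lambda>r. if r \<in> ?S then 0 else ?f n r))
      \<longlonglongrightarrow> integral {a'..b} (\<lambda>r. if r \<in> ?S then 0 else p r * (?G r)\<^sup>2 - q r * (Z r)\<^sup>2)"
  proof (rule dominated_convergence(2)[where h = "\<lambda>r. \<bar>p r\<bar> * L\<^sup>2 + \<bar>q r\<bar> * M\<^sup>2"])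
    have "?f n integrable_on {a'..b}" for n
    proof (intro integrable_continuous_interval continuous_intros cp czn')
      show "continuous_on {a'..b} (zn n)"
        using DERIV_continuous_on_greaterThan[OF dzn] sub by (rule continuous_on_subset)
    qed
    then show "(\<lambda>r. if r \<in> ?S then 0 else ?f n r) integrable_on {a'..b}" for n
      by (rule integrable_spike_finite[of ?S, rotated 2]) (use g(1) in auto)
    show "(\<lambda>r. \<bar>p r\<bar> * L\<^sup>2 + \<bar>q r\<bar> * M\<^sup>2) integrable_on {a'..b}"
      by (intro integrable_continuous_interval continuous_intros cp)
    fix n r assume "r \<in> {a'..b}"
    then have r: "r > 1" using a' by auto
    have "\<bar>?f n r\<bar> \<le> \<bar>p r\<bar> * (zn' n r)\<^sup>2 + \<bar>q r\<bar> * (zn n r)\<^sup>2"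
      by (rule order_trans[OF abs_triangle_ineq4]) (simp add: abs_mult)
    also have "\<dots> \<le> \<bar>p r\<bar> * L\<^sup>2 + \<bar>q r\<bar> * M\<^sup>2"
      using znbd[OF r, of n] zn'bd[of n r] by (intro add_mono mult_left_mono abs_le_square_iff[THEN iffD1]) auto
    finally show "norm (if r \<in> ?S then 0 else ?f n r) \<le> \<bar>p r\<bar> * L\<^sup>2 + \<bar>q r\<bar> * M\<^sup>2"
      by auto
  next
    fix r assume "r \<in> {a'..b}"
    then have r: "r > 1" using a' by auto
    show "(\<lambda>n. if r \<in> ?S then 0 else ?f n r) \<longlonglongrightarrow> (if r \<in> ?S then 0 else p r * (?G r)\<^sup>2 - q r * (Z r)\<^sup>2)"
    proof (cases "r \<in> ?S")
      case False
      then have "(\<lambda>n. ?f n r) \<longlonglongrightarrow> p r * (?G r)\<^sup>2 - q r * (Z r)\<^sup>2"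
        by (intro tendsto_intros limzn limzn' r)
      with False show ?thesis by (simp only: if_False)
    qed simp
  qed
  moreover have "integral {a'..b} (\<lambda>r. if r \<in> ?S then 0 else ?f n r) = integral {a'..b} (?f n)" for n
    by (rule integral_spike[of ?S]) (use g(1) in \<open>auto simp: negligible_finite\<close>)
  moreover have "integral {a'..b} (\<lambda>r. if r \<in> ?S then 0 else p r * (?G r)\<^sup>2 - q r * (Z r)\<^sup>2) = e"
  proof (rule integral_unique)
    have "((\<lambda>r. if r \<in> {a..b} then p r * (g r)\<^sup>2 - q r * (z r)\<^sup>2 else 0) has_integral e) {a'..b}"
      using I by (subst has_integral_restrict) (use a' in auto)
    then show "((\<lambda>r. if r \<in> ?S then 0 else p r * (?G r)\<^sup>2 - q r * (Z r)\<^sup>2) has_integral e) {a'..b}"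
      by (rule has_integral_spike_finite[of ?S, rotated 2]) (use g(1) Zin Zout in auto)
  qed
  ultimately show "0 \<le> e"
    using pos by (intro LIMSEQ_le_const) auto
qed

subsection \<open>Energies of piecewise test functions\<close>

text \<open>
  Test functions enter only through their end values and a bound \<open>e\<close> for their energy, so that
  they can be assembled from explicit pieces.
\<close>

definition energy_le ::
  "(real \<Rightarrow> real) \<Rightarrow> real \<Rightarrow> real \<Rightarrow> real \<Rightarrow> real \<Rightarrow> real \<Rightarrow> real \<Rightarrow> bool" where
  "energy_le p m a b \<alpha> \<beta> e \<longleftrightarrow> (\<exists>z g S L e'. continuous_on {a..b} z \<and> z a = \<alpha> \<and> z b = \<beta> \<and>
    finite S \<and> 0 \<le> L \<and> (\<forall>r\<in>{a<..<b} - S. (z has_real_derivative g r) (at r) \<and> \<bar>g r\<bar> \<le> L) \<and>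
    ((\<lambda>r. p r * (g r)\<^sup>2 - m * p r / r\<^sup>2 * (z r)\<^sup>2) has_integral e') {a..b} \<and> e' \<le> e)"

lemma energy_le_mono: "energy_le p m a b \<alpha> \<beta> e \<Longrightarrow> e \<le> e' \<Longrightarrow> energy_le p m a b \<alpha> \<beta> e'"
  unfolding energy_le_def by (elim ex_forward conj_forward) auto

text \<open>The junction \<open>b\<close> joins the exceptional set, so a kink there is allowed, and
  the energies add.\<close>

lemma energy_le_glue:
  assumes ab: "a \<le> b" "b \<le> c"
    and 1: "energy_le p m a b \<alpha> \<beta> e1" and 2: "energy_le p m b c \<beta> \<gamma> e2"
  shows "energy_le p m a c \<alpha> \<gamma> (e1 + e2)"
proof -
  obtain z1 g1 S1 L1 i1 where 1: "continuous_on {a..b} z1" "z1 a = \<alpha>" "z1 b = \<beta>" "finite S1" "0 \<le> L1"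
    "\<And>r. r\<in>{a<..<b} - S1 \<Longrightarrow> (z1 has_real_derivative g1 r) (at r)"
    "\<And>r. r\<in>{a<..<b} - S1 \<Longrightarrow> \<bar>g1 r\<bar> \<le> L1"
    "((\<lambda>r. p r * (g1 r)\<^sup>2 - m * p r / r\<^sup>2 * (z1 r)\<^sup>2) has_integral i1) {a..b}" "i1 \<le> e1"
    using 1 unfolding energy_le_def by blast
  obtain z2 g2 S2 L2 i2 where 2: "continuous_on {b..c} z2" "z2 b = \<beta>" "z2 c = \<gamma>" "finite S2" "0 \<le> L2"
    "\<And>r. r\<in>{b<..<c} - S2 \<Longrightarrow> (z2 has_real_derivative g2 r) (at r)"
    "\<And>r. r\<in>{b<..<c} - S2 \<Longrightarrow> \<bar>g2 r\<bar> \<le> L2"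
    "((\<lambda>r. p r * (g2 r)\<^sup>2 - m * p r / r\<^sup>2 * (z2 r)\<^sup>2) has_integral i2) {b..c}" "i2 \<le> e2"
    using 2 unfolding energy_le_def by blast
  define z where "z r = (if r \<le> b then z1 r else z2 r)" for r
  define g where "g r = (if r \<le> b then g1 r else g2 r)" for r
  have "continuous_on {a..c} z"
  proof -
    have "continuous_on ({a..b} \<union> {b..c}) z"
      unfolding z_def using 1(1,3) 2(1,2) by (intro continuous_on_cases) auto
    then show ?thesis using ab by (simp add: ivl_disj_un_two_touch)
  qed
  moreover have "(z has_real_derivative g r) (at r) \<and> \<bar>g r\<bar> \<le> max L1 L2"
    if r: "r \<in> {a<..<c} - (insert b (S1 \<union> S2))" for r
  proof (cases "r < b")
    case True
    then have "(z1 has_real_derivative g1 r) (at r)" "\<bar>g1 r\<bar> \<le> L1" using 1(6,7) r by auto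
    moreover have "(z has_real_derivative g1 r) (at r)"
      by (rule has_field_derivative_transform_within_open[OF calculation(1), of "{..<b}"])
        (use True in \<open>auto simp: z_def\<close>)
    ultimately show ?thesis using True by (simp add: g_def)
  next
    case False
    with r have rb: "r > b" by auto
    then have "(z2 has_real_derivative g2 r) (at r)" "\<bar>g2 r\<bar> \<le> L2" using 2(6,7) r by auto
    moreover have "(z has_real_derivative g2 r) (at r)"
      by (rule has_field_derivative_transform_within_open[OF calculation(1), of "{b<..}"])
        (use rb in \<open>auto simp: z_def\<close>)
    ultimately show ?thesis using rb by (simp add: g_def)
  qed
  moreover have "((\<lambda>r. p r * (g r)\<^sup>2 - m * p r / r\<^sup>2 * (z r)\<^sup>2) has_integral (i1 + i2)) {a..c}"
  proof (rule has_integral_combine[OF ab])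
    show "((\<lambda>r. p r * (g r)\<^sup>2 - m * p r / r\<^sup>2 * (z r)\<^sup>2) has_integral i1) {a..b}"
      by (rule has_integral_spike_finite[OF _ _ 1(8), of "{}"]) (auto simp: z_def g_def)
    show "((\<lambda>r. p r * (g r)\<^sup>2 - m * p r / r\<^sup>2 * (z r)\<^sup>2) has_integral i2) {b..c}"
      by (rule has_integral_spike_finite[OF _ _ 2(8), of "{b}"]) (auto simp: z_def g_def)
  qed
  moreover have "z a = \<alpha>" "z c = \<gamma>" using 1 2 ab by (auto simp: z_def)
  moreover have "finite (insert b (S1 \<union> S2))" "0 \<le> max L1 L2" "i1 + i2 \<le> e1 + e2"
    using 1(4,5,9) 2(4,5,9) by auto
  ultimately show ?thesis unfolding energy_le_def
    by (intro exI[of _ z] exI[of _ g] exI[of _ "insert b (S1 \<union> S2)"] exI[of _ "max L1 L2"] exI[of _ "i1 + i2"]) auto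
qed

lemma energy_le_C1:
  assumes a: "0 < a" "a \<le> b" and z: "\<And>r. r \<in> {a..b} \<Longrightarrow> (z has_real_derivative g r) (at r within {a..b})"
    and cont: "continuous_on {a..b} g" "continuous_on {a..b} p"
    and e: "integral {a..b} (\<lambda>r. p r * (g r)\<^sup>2 - m * p r / r\<^sup>2 * (z r)\<^sup>2) \<le> e"
  shows "energy_le p m a b (z a) (z b) e"
proof -
  have cz: "continuous_on {a..b} z" using z by (rule DERIV_continuous_on)
  obtain L where L: "L > 0" "\<And>r. r \<in> {a..b} \<Longrightarrow> \<bar>g r\<bar> \<le> L"
    using compact_imp_bounded[OF compact_continuous_image[OF cont(1)]] unfolding bounded_pos
    by auto
  let ?f = "\<lambda>r. p r * (g r)\<^sup>2 - m * p r / r\<^sup>2 * (z r)\<^sup>2"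
  have "?f integrable_on {a..b}"
    using a by (intro integrable_continuous_interval continuous_intros cz cont) auto
  moreover have "(z has_real_derivative g r) (at r) \<and> \<bar>g r\<bar> \<le> L" if "r \<in> {a<..<b} - {}" for r
    using z[of r] L(2)[of r] that by (simp add: at_within_Icc_at)
  ultimately show ?thesis
    unfolding energy_le_def using cz e L(1)
    by (intro exI[of _ z] exI[of _ g] exI[of _ "{}"] exI[of _ L] exI[of _ "integral {a..b} ?f"])
      (simp add: integrable_integral)
qed

text \<open>For a power the kinetic and the potential density are both multiples of
  \<open>p r * r powr (2 * \<alpha> - 2)\<close>, with coefficients in the ratio of
  \<open>\<alpha>^2\<close> to \<open>m\<close>; for nonnegative \<open>p\<close> the sign of
  \<open>\<alpha>^2 - m\<close> therefore decides.\<close>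

lemma energy_le_power:
  assumes a: "0 < a" "a \<le> b" and p: "continuous_on {a..b} p"
  shows "energy_le p m a b (c * a powr \<alpha>) (c * b powr \<alpha>)
    ((\<alpha>\<^sup>2 - m) * c\<^sup>2 * integral {a..b} (\<lambda>r. p r * r powr (2 * \<alpha> - 2)))"
proof (rule energy_le_C1[OF a _ _ p, where z = "\<lambda>r. c * r powr \<alpha>" and g = "\<lambda>r. c * (\<alpha> * r powr (\<alpha> - 1))"])
  show "((\<lambda>r. c * r powr \<alpha>) has_real_derivative c * (\<alpha> * r powr (\<alpha> - 1))) (at r within {a..b})"
    if "r \<in> {a..b}" for r
    using that a by (intro DERIV_cmult has_field_derivative_at_within[OF has_real_derivative_powr]) auto
  show "continuous_on {a..b} (\<lambda>r. c * (\<alpha> * r powr (\<alpha> - 1)))"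
    using a by (intro continuous_intros) auto
  have "p r * (c * (\<alpha> * r powr (\<alpha> - 1)))\<^sup>2 - m * p r / r\<^sup>2 * (c * r powr \<alpha>)\<^sup>2
      = (\<alpha>\<^sup>2 - m) * c\<^sup>2 * (p r * r powr (2 * \<alpha> - 2))" if "r \<in> {a..b}" for r
  proof -
    have r: "r > 0" using that a by auto
    have 1: "(r powr (\<alpha> - 1))\<^sup>2 = r powr (2 * \<alpha> - 2)"
      using r by (simp add: power2_eq_square powr_add[symmetric])
    have "(r powr \<alpha>)\<^sup>2 = r powr (2 * \<alpha> - 2) * r powr 2"
      using r by (simp only: power2_eq_square powr_add[symmetric]) simp
    then have 2: "(r powr \<alpha>)\<^sup>2 = r powr (2 * \<alpha> - 2) * r\<^sup>2" using r by simp
    show ?thesis unfolding power_mult_distrib 1 2 using r by (simp add: field_simps)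
  qed
  then show "integral {a..b} (\<lambda>r. p r * (c * (\<alpha> * r powr (\<alpha> - 1)))\<^sup>2 - m * p r / r\<^sup>2 * (c * r powr \<alpha>)\<^sup>2)
      \<le> (\<alpha>\<^sup>2 - m) * c\<^sup>2 * integral {a..b} (\<lambda>r. p r * r powr (2 * \<alpha> - 2))"
    by (subst Henstock_Kurzweil_Integration.integral_cong) auto
qed

text \<open>The subtracted potential part is nonnegative and is dropped; the squared slope times the
  mass of \<open>p\<close> remains.\<close>

lemma energy_le_linear:
  assumes a: "0 < a" "a < b" and p: "continuous_on {a..b} p" "\<And>r. r \<in> {a..b} \<Longrightarrow> 0 \<le> p r" and m: "0 \<le> m"
  shows "energy_le p m a b \<alpha> \<beta> (((\<beta> - \<alpha>) / (b - a))\<^sup>2 * integral {a..b} p)"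
proof -
  let ?k = "(\<beta> - \<alpha>) / (b - a)"
  let ?z = "\<lambda>r. \<alpha> + ?k * (r - a)"
  have "energy_le p m a b (?z a) (?z b) (?k\<^sup>2 * integral {a..b} p)"
  proof (rule energy_le_C1[where g = "\<lambda>_. ?k"])
    have "integral {a..b} (\<lambda>r. p r * ?k\<^sup>2 - m * p r / r\<^sup>2 * (?z r)\<^sup>2) \<le> integral {a..b} (\<lambda>r. ?k\<^sup>2 * p r)"
      using a p m by (intro integral_le integrable_continuous_interval continuous_intros p(1)) auto
    then show "integral {a..b} (\<lambda>r. p r * ?k\<^sup>2 - m * p r / r\<^sup>2 * (?z r)\<^sup>2) \<le> ?k\<^sup>2 * integral {a..b} p"
      by simp
    show "(?z has_real_derivative ?k) (at r within {a..b})" for r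
    proof -
      have "((\<lambda>r. \<alpha> + k * (r - a)) has_real_derivative k) (at r within {a..b})" for k
        by (auto intro!: derivative_eq_intros)
      then show ?thesis .
    qed
  qed (use a p(1) in auto)
  moreover have "?z b = \<beta>" "?z a = \<alpha>" using a by auto
  ultimately show ?thesis by metis
qed

text \<open>The cut-off of least \<open>p\<close>-energy from \<open>\<beta>\<close> at \<open>a\<close> to 0 at \<open>b\<close>.\<close>

lemma energy_le_cutoff:
  assumes a: "0 < a" "a < b" and p: "continuous_on {a..b} p" "\<And>r. r \<in> {a..b} \<Longrightarrow> 0 < p r" and m: "0 \<le> m"
  shows "energy_le p m a b \<beta> 0 (\<beta>\<^sup>2 / integral {a..b} (\<lambda>r. 1 / p r))"
proof -
  \<comment> \<open>The cut-off \<open>1 - G s / G b\<close> makes \<open>p\<close> times the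
    derivative constant, which is the Euler-Lagrange equation of the kinetic energy; that energy
    then equals \<open>\<beta>^2 / G b\<close>, and the potential part is dropped.\<close>
  define G where "G s = integral {a..s} (\<lambda>r. 1 / p r)" for s
  have cp: "continuous_on {a..b} (\<lambda>r. 1 / p r)"
    using p by (intro continuous_intros) force+
  have dG: "(G has_real_derivative 1 / p s) (at s within {a..b})" if "s \<in> {a..b}" for s
    unfolding G_def using integral_has_real_derivative[OF cp that] .
  have "G a < G b"
  proof (rule DERIV_pos_imp_increasing_open[OF a(2)])
    fix x assume "a < x" "x < b"
    then show "\<exists>y. (G has_real_derivative y) (at x) \<and> y > 0"
      using dG[of x] p(2)[of x] by (auto simp: at_within_Icc_at intro!: exI[of _ "1 / p x"])
  next
    show "continuous_on {a..b} G" using dG by (rule DERIV_continuous_on)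
  qed
  then have Gb: "G b > 0" by (simp add: G_def)
  let ?z = "\<lambda>s. \<beta> * (1 - G s / G b)"
  let ?g = "\<lambda>s. - \<beta> / G b / p s"
  have "energy_le p m a b (?z a) (?z b) (\<beta>\<^sup>2 / G b)"
  proof (rule energy_le_C1[where g = ?g])
    show "(?z has_real_derivative ?g r) (at r within {a..b})" if "r \<in> {a..b}" for r
      using Gb by (auto intro!: derivative_eq_intros dG[OF that])
    have cg: "continuous_on {a..b} ?g"
      using p Gb by (intro continuous_intros) force+
    then show "continuous_on {a..b} ?g" .
    have cz: "continuous_on {a..b} ?z"
      using Gb by (intro continuous_intros DERIV_continuous_on[OF dG]) auto
    have "integral {a..b} (\<lambda>r. p r * (?g r)\<^sup>2 - m * p r / r\<^sup>2 * (?z r)\<^sup>2)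
        \<le> integral {a..b} (\<lambda>r. (\<beta> / G b)\<^sup>2 * (1 / p r))"
    proof (intro integral_le integrable_continuous_interval)
      show "continuous_on {a..b} (\<lambda>r. p r * (?g r)\<^sup>2 - m * p r / r\<^sup>2 * (?z r)\<^sup>2)"
        using a by (intro continuous_on_diff continuous_on_mult continuous_on_power continuous_on_divide
           continuous_on_id continuous_on_const p(1) cg cz) auto
      show "continuous_on {a..b} (\<lambda>r. (\<beta> / G b)\<^sup>2 * (1 / p r))"
        by (intro continuous_on_mult continuous_on_const cp)
      fix r assume r: "r \<in> {a..b}"
      then have "p r * (?g r)\<^sup>2 = (\<beta> / G b)\<^sup>2 * (1 / p r)"
        using p(2)[OF r] by (simp add: power2_eq_square field_simps)
      moreover have "0 \<le> m * p r / r\<^sup>2 * (?z r)\<^sup>2"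
        using p(2)[OF r] m by (intro mult_nonneg_nonneg divide_nonneg_nonneg) auto
      ultimately show "p r * (?g r)\<^sup>2 - m * p r / r\<^sup>2 * (?z r)\<^sup>2 \<le> (\<beta> / G b)\<^sup>2 * (1 / p r)"
        by linarith
    qed
    also have "\<dots> = (\<beta> / G b)\<^sup>2 * G b"
      unfolding G_def by (rule integral_mult_right)
    also have "\<dots> = \<beta>\<^sup>2 / G b" using Gb by (simp add: power2_eq_square)
    finally show "integral {a..b} (\<lambda>r. p r * (?g r)\<^sup>2 - m * p r / r\<^sup>2 * (?z r)\<^sup>2) \<le> \<beta>\<^sup>2 / G b" .
  qed (use a p(1) in auto)
  moreover have "?z a = \<beta>" "?z b = 0" using Gb by (auto simp: G_def)
  ultimately show ?thesis unfolding G_def by metis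
qed

section \<open>Consequences of the weighted Hardy inequality for an abstract weight\<close>

text \<open>To be instantiated with \<open>p r = r ^ n * (W r)^2\<close> and
  \<open>m = n = N - 1\<close>. The inequality is phrased through \<open>energy_le\<close> so that
  any function glued from explicit pieces and vanishing at both ends can be inserted.\<close>

locale stable_weight =
  fixes p :: "real \<Rightarrow> real" and m :: real
  assumes p_cont: "continuous_on {1<..} p" and p_nonneg: "\<And>r. r > 1 \<Longrightarrow> 0 \<le> p r"
    and m_pos: "0 < m"
    and energy_nonneg: "\<And>a b e. 1 < a \<Longrightarrow> a < b \<Longrightarrow> energy_le p m a b 0 0 e \<Longrightarrow> 0 \<le> e"
begin

lemma p_cont': "1 < a \<Longrightarrow> continuous_on {a..b} p"
  using p_cont by (rule continuous_on_subset) auto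

lemma powr_cont: "0 < a \<Longrightarrow> continuous_on {a..b} (\<lambda>s. s powr \<gamma> :: real)"
  by (intro continuous_intros) auto

lemma p_powr_cont: "1 < a \<Longrightarrow> continuous_on {a..b} (\<lambda>s. p s * s powr \<gamma>)"
  by (intro continuous_on_mult p_cont' powr_cont) auto

lemma p_powr_integrable: "1 < a \<Longrightarrow> (\<lambda>s. p s * s powr \<gamma>) integrable_on {a..b}"
  by (intro integrable_continuous_interval p_powr_cont)

lemma p_powr_nonneg: "1 < a \<Longrightarrow> 0 \<le> integral {a..b} (\<lambda>s. p s * s powr \<gamma>)"
  using p_nonneg by (intro integral_nonneg p_powr_integrable) auto

text \<open>\<open>K\<close> expresses that \<open>p\<close> has double zeros at \<open>r1\<close>
  and \<open>r2\<close>. Affine ramps of width \<open>h\<close> at these points cost at most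
  \<open>K * h\<close> each, so as \<open>h\<close> tends to 0 only the plateau 1 between them
  counts, and its energy is \<open>- m\<close> times the integral of \<open>p / s^2\<close>.\<close>

lemma vanish_between_zeros:
  assumes r: "1 < r1" "r1 < s" "s < r2"
    and K: "\<And>t. t \<in> {r1..r2} \<Longrightarrow> p t \<le> K * (t - r1)\<^sup>2" "\<And>t. t \<in> {r1..r2} \<Longrightarrow> p t \<le> K * (r2 - t)\<^sup>2"
  shows "p s = 0"
proof -
  \<comment> \<open>Half the distance to the nearer zero, so that \<open>s\<close> lies on every
    plateau with \<open>h \<le> h0\<close>.\<close>
  define h0 where "h0 = min (s - r1) (r2 - s) / 2"
  have h0: "h0 > 0" "r1 + h0 < s" "s < r2 - h0" using r by (auto simp: h0_def field_simps min_def)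
  have K0: "K \<ge> 0"
  proof -
    have "0 \<le> K * (r2 - r1)\<^sup>2" using K(1)[of r2] p_nonneg[of r2] r by auto
    then show ?thesis using r by (auto simp: zero_le_mult_iff)
  qed
  let ?J = "\<lambda>h. integral {r1+h..r2-h} (\<lambda>s. p s * s powr (- 2))"
  have *: "m * ?J h0 \<le> 2 * K * h" if h: "0 < h" "h \<le> h0" for h
  proof -
    have ramp: "integral {a..a+h} p \<le> K * h^2 * h"
      if "1 < a" "\<And>t. t \<in> {a..a+h} \<Longrightarrow> p t \<le> K * h^2" for a
    proof -
      have "integral {a..a+h} p \<le> integral {a..a+h} (\<lambda>_. K * h^2)"
        using that by (intro integral_le integrable_continuous_interval p_cont') auto
      then show ?thesis using h by (simp add: mult_ac)
    qed
    have bd: "K * (t - c)\<^sup>2 \<le> K * h\<^sup>2" if "\<bar>t - c\<bar> \<le> h" for t c :: real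
      using that K0 h by (intro mult_left_mono abs_le_square_iff[THEN iffD1]) auto
    have 1: "integral {r1..r1+h} p \<le> K * h^2 * h"
    proof (rule ramp)
      fix t assume "t \<in> {r1..r1+h}"
      with K(1)[of t] bd[of t r1] h h0 show "p t \<le> K * h\<^sup>2" by auto
    qed (use r in auto)
    have 2: "integral {r2-h..r2} p \<le> K * h^2 * h"
    proof -
      have "integral {r2-h..r2-h+h} p \<le> K * h^2 * h"
      proof (rule ramp)
        fix t assume "t \<in> {r2-h..r2-h+h}"
        with K(2)[of t] bd[of r2 t] h h0 show "p t \<le> K * h\<^sup>2" by auto
      qed (use r h h0 in auto)
      then show ?thesis by simp
    qed
    have e1: "energy_le p m r1 (r1 + h) 0 1 (((1 - 0) / (r1 + h - r1))\<^sup>2 * integral {r1..r1+h} p)"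
      using r h h0 p_nonneg m_pos by (intro energy_le_linear p_cont') auto
    have e1': "energy_le p m r1 (r1 + h) 0 1 (K * h)"
      by (rule energy_le_mono[OF e1]) (use 1 h in \<open>simp add: divide_simps power2_eq_square mult_ac\<close>)
    have e2: "energy_le p m (r1 + h) (r2 - h) 1 1 (- m * ?J h)"
      using energy_le_power[of "r1 + h" "r2 - h" p m 1 0] p_cont'[of "r1 + h" "r2 - h"] r h h0 by simp
    have e3: "energy_le p m (r2 - h) r2 1 0 (((0 - 1) / (r2 - (r2 - h)))\<^sup>2 * integral {r2-h..r2} p)"
      using r h h0 p_nonneg m_pos by (intro energy_le_linear p_cont') auto
    have e3': "energy_le p m (r2 - h) r2 1 0 (K * h)"
      by (rule energy_le_mono[OF e3]) (use 2 h in \<open>simp add: divide_simps power2_eq_square mult_ac\<close>)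
    have "energy_le p m r1 r2 0 0 (K * h + (- m * ?J h) + K * h)"
      using r h h0 by (intro energy_le_glue[OF _ _ energy_le_glue[OF _ _ e1' e2] e3']) auto
    from energy_nonneg[OF _ _ this] r have "m * ?J h \<le> 2 * K * h" by simp
    moreover have "?J h0 \<le> ?J h"
      using r h h0 p_nonneg by (intro integral_subset_le p_powr_integrable) auto
    ultimately show ?thesis using m_pos mult_left_mono[of "?J h0" "?J h" m] by linarith
  qed
  have "m * ?J h0 \<le> 0"
  proof (rule tendsto_lowerbound)
    show "((\<lambda>h. 2 * K * h) \<longlongrightarrow> 0) (at_right 0)"
      by (auto intro!: tendsto_eq_intros)
    show "\<forall>\<^sub>F h in at_right 0. m * ?J h0 \<le> 2 * K * h"
      using eventually_at_right_real[OF h0(1)] by eventually_elim (use * in auto)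
  qed auto
  then have "?J h0 = 0"
    using m_pos p_powr_nonneg[of "r1 + h0" "r2 - h0" "-2"] r h0 by (auto simp: mult_le_0_iff)
  then have "p s * s powr (- 2) = 0"
    by (subst (asm) integral_eq_0_iff) (use r h0 p_nonneg in \<open>auto intro!: p_powr_cont\<close>)
  then show ?thesis using r by auto
qed

text \<open>The fixed price at which every test function leaves 0; the maximum with 1 in the proof
  makes it positive.\<close>

lemma energy_le_start:
  assumes "1 < a" "a < b"
  shows "\<exists>C>0. energy_le p m a b 0 \<beta> C"
proof -
  have "energy_le p m a b 0 \<beta> (((\<beta> - 0) / (b - a))\<^sup>2 * integral {a..b} p)"
    using assms p_nonneg m_pos by (intro energy_le_linear p_cont') auto
  then have "energy_le p m a b 0 \<beta> (max 1 (((\<beta> - 0) / (b - a))\<^sup>2 * integral {a..b} p))"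
    by (rule energy_le_mono) auto
  then show ?thesis by (intro exI conjI) auto
qed

text \<open>At the critical Hardy exponents, plus or minus \<open>sqrt m\<close>, kinetic and
  potential part cancel: such a piece bridges any distance for free.\<close>

lemma energy_le_power_sqrt:
  assumes "1 < a" "a \<le> b" "\<alpha>\<^sup>2 = m"
  shows "energy_le p m a b (c * a powr \<alpha>) (c * b powr \<alpha>) 0"
  using energy_le_power[of a b p m c \<alpha>] assms p_cont'[of a b] by simp

context
  fixes a :: real
  assumes a: "1 < a" and pos: "\<And>r. r \<ge> a \<Longrightarrow> 0 < p r"
begin

lemma inverse_cont:
  assumes "a \<le> b"
  shows "continuous_on {b..c} (\<lambda>r. 1 / p r)"
proof -
  have "p r \<noteq> 0" if "r \<in> {b..c}" for r using pos[of r] that assms by simp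
  then show ?thesis using a assms by (intro continuous_on_divide continuous_on_const p_cont') auto
qed

lemma inverse_integrable: "a \<le> b \<Longrightarrow> (\<lambda>r. 1 / p r) integrable_on {b..c}"
  by (intro integrable_continuous_interval inverse_cont)

text \<open>Test function: a ramp on \<open>[a, a + 1]\<close>, the free power
  \<open>s powr y\<close> up to \<open>r\<close>, then \<open>c * s powr \<alpha>\<close> on
  \<open>[r, R]\<close> with nonpositive energy, and a cut-off on \<open>[R, T]\<close> of cost at
  most 1. The ramp cost \<open>C\<close> depends on neither \<open>r\<close> nor \<open>R\<close>,
  so it bounds the negative energy uniformly; dividing by \<open>c^2\<close> produces the power of
  \<open>r\<close>.\<close>

lemma decay_of_inverse_unbounded:
  assumes unbdd: "\<And>K. \<exists>T>a. integral {a..T} (\<lambda>r. 1 / p r) > K" and \<alpha>: "\<bar>\<alpha>\<bar> < sqrt m"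
  shows "\<exists>C>0. \<forall>r R. a + 1 \<le> r \<longrightarrow> r \<le> R \<longrightarrow>
    integral {r..R} (\<lambda>s. p s * s powr (2 * \<alpha> - 2)) \<le> C * r powr (2 * \<alpha> - 2 * sqrt m)"
proof -
  define y where "y = sqrt m"
  have ym: "y\<^sup>2 = m" using m_pos by (simp add: y_def)
  have \<alpha>m: "0 < m - \<alpha>\<^sup>2"
    using \<alpha> power_strict_mono[of "\<bar>\<alpha>\<bar>" y 2] ym by (simp add: y_def)
  obtain C where C: "C > 0" and start: "energy_le p m a (a + 1) 0 ((a + 1) powr y) C"
    using energy_le_start[OF a, of "a + 1" "(a + 1) powr y"] by auto
  show ?thesis
  proof (intro exI[of _ "(C + 1) / (m - \<alpha>\<^sup>2)"] conjI allI impI)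
    fix r R assume r: "a + 1 \<le> r" "r \<le> R"
    let ?I = "integral {r..R} (\<lambda>s. p s * s powr (2 * \<alpha> - 2))"
    \<comment> \<open>Continuity at \<open>r\<close> requires
      \<open>c * r powr \<alpha> = r powr y\<close>.\<close>
    define c where "c = r powr (y - \<alpha>)"
    define \<beta> where "\<beta> = c * R powr \<alpha>"
    \<comment> \<open>\<open>T\<close> is so far out that \<open>1 / p\<close> has integral above
      \<open>\<beta>^2\<close> over \<open>[R, T]\<close>, which makes the optimal cut-off cost at
      most 1.\<close>
    obtain T where T: "T > a" "integral {a..T} (\<lambda>r. 1 / p r) > \<beta>\<^sup>2 + integral {a..R} (\<lambda>r. 1 / p r)"
      using unbdd by blast
    have RT: "R < T"
    proof (rule ccontr)
      assume "\<not> R < T"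
      then have "integral {a..T} (\<lambda>r. 1 / p r) \<le> integral {a..R} (\<lambda>r. 1 / p r)"
        using r by (intro integral_subset_le inverse_integrable) (auto intro: less_imp_le[OF pos])
      then show False using T(2) zero_le_power2[of \<beta>] by linarith
    qed
    have G: "integral {R..T} (\<lambda>r. 1 / p r) > \<beta>\<^sup>2"
      using Henstock_Kurzweil_Integration.integral_combine[of a R T "\<lambda>r. 1 / p r"] inverse_integrable[of a T] T RT r
      by auto
    have e1: "energy_le p m (a + 1) r ((a + 1) powr y) (r powr y) 0"
      using energy_le_power_sqrt[of "a + 1" r y 1] a r ym by simp
    have e2: "energy_le p m r R (r powr y) \<beta> ((\<alpha>\<^sup>2 - m) * c\<^sup>2 * ?I)"
    proof -
      have "r powr y = c * r powr \<alpha>" using a r by (simp add: c_def powr_add[symmetric])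
      then show ?thesis unfolding \<beta>_def
        using a r by (auto intro!: energy_le_power p_cont')
    qed
    have e3: "energy_le p m R T \<beta> 0 (\<beta>\<^sup>2 / integral {R..T} (\<lambda>r. 1 / p r))"
      using a r RT pos m_pos by (intro energy_le_cutoff p_cont') auto
    have e3': "energy_le p m R T \<beta> 0 1"
    proof (rule energy_le_mono[OF e3])
      have "0 < integral {R..T} (\<lambda>r. 1 / p r)" using G zero_le_power2[of \<beta>] by linarith
      then show "\<beta>\<^sup>2 / integral {R..T} (\<lambda>r. 1 / p r) \<le> 1" using G by (simp add: divide_le_eq)
    qed
    have "energy_le p m a T 0 0 (C + 0 + (\<alpha>\<^sup>2 - m) * c\<^sup>2 * ?I + 1)"
      using a r RT
      by (intro energy_le_glue[OF _ _ energy_le_glue[OF _ _ energy_le_glue[OF _ _ start e1] e2] e3']) auto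
    from energy_nonneg[OF a T(1) this] have "(m - \<alpha>\<^sup>2) * (c\<^sup>2 * ?I) \<le> C + 1"
      by (simp add: algebra_simps)
    then have *: "c\<^sup>2 * ?I \<le> (C + 1) / (m - \<alpha>\<^sup>2)"
      using \<alpha>m by (simp add: pos_le_divide_eq mult.commute)
    have c2: "c\<^sup>2 * r powr (2 * \<alpha> - 2 * y) = 1"
      using a r by (simp add: c_def power2_eq_square powr_add[symmetric])
    have "?I = (c\<^sup>2 * r powr (2 * \<alpha> - 2 * y)) * ?I" by (simp add: c2)
    also have "\<dots> = (c\<^sup>2 * ?I) * r powr (2 * \<alpha> - 2 * y)" by (simp add: mult_ac)
    also have "\<dots> \<le> (C + 1) / (m - \<alpha>\<^sup>2) * r powr (2 * \<alpha> - 2 * y)"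
      using * by (intro mult_right_mono) auto
    finally show "?I \<le> (C + 1) / (m - \<alpha>\<^sup>2) * r powr (2 * \<alpha> - 2 * sqrt m)" by (simp add: y_def)
  qed (use C \<alpha>m in auto)
qed

text \<open>Test function: a ramp on \<open>[a, a + 1]\<close>, the plateau 1 up to
  \<open>t\<close>, the free power \<open>s powr (- y)\<close> scaled to 1 at \<open>t\<close>, and
  the optimal cut-off on \<open>[r, R]\<close>. As the plateau brings the energy down to -1 or less,
  the cut-off must cost at least 1, which means that the integral of \<open>1 / p\<close> is
  small.\<close>

lemma inverse_decay_of_inverse_bounded:
  assumes bdd: "\<And>T. T \<ge> a \<Longrightarrow> integral {a..T} (\<lambda>r. 1 / p r) \<le> K"
  shows "\<exists>C t. C > 0 \<and> t \<ge> a \<and> (\<forall>r R. t \<le> r \<longrightarrow> r < R \<longrightarrow>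
    integral {r..R} (\<lambda>s. 1 / p s) \<le> C * r powr (- 2 * sqrt m))"
proof -
  define y where "y = sqrt m"
  have ym: "(- y)\<^sup>2 = m" using m_pos by (simp add: y_def)
  obtain C where C: "C > 0" and start: "energy_le p m a (a + 1) 0 1 C"
    using energy_le_start[OF a, of "a + 1" 1] by auto
  \<comment> \<open>Integrates \<open>2 / s \<le> p / s^2 + 1 / p\<close>, the inequality of
    arithmetic and geometric means: where the integral of \<open>1 / p\<close> stays bounded, that
    of \<open>p / s^2\<close> grows at least logarithmically.\<close>
  have low: "2 * ln (t / (a + 1)) - K \<le> integral {a+1..t} (\<lambda>s. p s * s powr (- 2))" if t: "t \<ge> a + 1" for t
  proof -
    have "((\<lambda>s. 2 / s) has_integral (2 * ln t - 2 * ln (a + 1))) {a+1..t}"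
    proof (rule fundamental_theorem_of_calculus[OF t])
      fix s assume "s \<in> {a+1..t}"
      then have "((\<lambda>s. 2 * ln s) has_real_derivative 2 / s) (at s)"
        using a by (auto intro!: derivative_eq_intros)
      then show "((\<lambda>s. 2 * ln s) has_vector_derivative 2 / s) (at s within {a+1..t})"
        by (simp add: has_real_derivative_iff_has_vector_derivative has_vector_derivative_at_within)
    qed
    moreover have "((\<lambda>s. p s * s powr (- 2) + 1 / p s) has_integral
        (integral {a+1..t} (\<lambda>s. p s * s powr (- 2)) + integral {a+1..t} (\<lambda>s. 1 / p s))) {a+1..t}"
      using a by (intro has_integral_add integrable_integral p_powr_integrable inverse_integrable) auto
    moreover have "2 / s \<le> p s * s powr (- 2) + 1 / p s" if "s \<in> {a+1..t}" for s
    proof -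
      have s: "s > 0" "p s > 0" using that a pos by auto
      have "0 \<le> (p s / s - 1)\<^sup>2 / p s" using s by simp
      also have "\<dots> = p s / s\<^sup>2 + 1 / p s - 2 / s"
        using s by (simp add: field_simps power2_eq_square)
      also have "p s / s\<^sup>2 = p s * s powr (- 2)" using s by (simp add: powr_minus divide_inverse)
      finally show ?thesis by simp
    qed
    ultimately have "2 * ln t - 2 * ln (a + 1)
        \<le> integral {a+1..t} (\<lambda>s. p s * s powr (- 2)) + integral {a+1..t} (\<lambda>s. 1 / p s)"
      by (rule has_integral_le)
    moreover have "integral {a+1..t} (\<lambda>s. 1 / p s) \<le> integral {a..t} (\<lambda>s. 1 / p s)"
      using a by (intro integral_subset_le inverse_integrable) (auto intro: less_imp_le[OF pos])
    moreover have "integral {a..t} (\<lambda>s. 1 / p s) \<le> K" using bdd t by simp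
    ultimately show ?thesis using a t by (simp add: ln_div)
  qed
  \<comment> \<open>Solves \<open>2 * ln (t / (a + 1)) = (C + 1) / m + \<bar>K\<bar>\<close>, so
    that by \<open>low\<close> the plateau outweighs the ramp by at least 1.\<close>
  define t where "t = (a + 1) * exp (((C + 1) / m + \<bar>K\<bar>) / 2)"
  have "1 \<le> exp (((C + 1) / m + \<bar>K\<bar>) / 2)" using C m_pos by simp
  then have t: "t \<ge> a + 1" using a by (simp add: t_def)
  have "2 * ln (t / (a + 1)) = (C + 1) / m + \<bar>K\<bar>" using a by (simp add: t_def)
  with low[OF t] have "(C + 1) / m \<le> integral {a+1..t} (\<lambda>s. p s * s powr (- 2))" by linarith
  then have J: "C + 1 \<le> m * integral {a+1..t} (\<lambda>s. p s * s powr (- 2))"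
    using m_pos by (simp add: pos_divide_le_eq mult.commute)
  show ?thesis
  proof (rule exI[of _ "t powr (2 * y)"], rule exI[of _ t], intro conjI allI impI)
    fix r R assume r: "t \<le> r" "r < R"
    define \<beta> where "\<beta> = t powr y * r powr (- y)"
    define G where "G = integral {r..R} (\<lambda>s. 1 / p s)"
    have e1: "energy_le p m (a + 1) t 1 1 (- m * integral {a+1..t} (\<lambda>s. p s * s powr (- 2)))"
      using energy_le_power[of "a + 1" t p m 1 0] p_cont'[of "a + 1" t] a t by simp
    have e2: "energy_le p m t r 1 \<beta> 0"
    proof -
      have "t powr y * t powr (- y) = 1" using a t by (simp add: powr_add[symmetric])
      then show ?thesis
        using energy_le_power_sqrt[of t r "- y" "t powr y"] a t r ym unfolding \<beta>_def by simp
    qed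
    have e3: "energy_le p m r R \<beta> 0 (\<beta>\<^sup>2 / G)"
      unfolding G_def using a t r pos m_pos by (intro energy_le_cutoff p_cont') auto
    have "energy_le p m a R 0 0 (C + (- m * integral {a+1..t} (\<lambda>s. p s * s powr (- 2))) + 0 + \<beta>\<^sup>2 / G)"
      using a t r
      by (intro energy_le_glue[OF _ _ energy_le_glue[OF _ _ energy_le_glue[OF _ _ start e1] e2] e3]) auto
    from energy_nonneg[OF a _ this] a t r J have "1 \<le> \<beta>\<^sup>2 / G" by simp
    moreover have "0 \<le> G"
      unfolding G_def using t r
      by (intro integral_nonneg inverse_integrable) (auto intro: less_imp_le[OF pos])
    \<comment> \<open>The case \<open>G = 0\<close> is excluded as well, since the quotient would
      then be 0 by convention.\<close>
    ultimately have "G \<le> \<beta>\<^sup>2" by (simp add: le_divide_eq split: if_splits)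
    also have "\<beta>\<^sup>2 = t powr (2 * y) * r powr (- 2 * y)"
      unfolding \<beta>_def power_mult_distrib using a t r by (simp add: power2_eq_square powr_add[symmetric])
    finally show "integral {r..R} (\<lambda>s. 1 / p s) \<le> t powr (2 * y) * r powr (- 2 * sqrt m)"
      by (simp add: G_def y_def)
  qed (use a t in auto)
qed

end

end

subsection \<open>Auxiliary integral estimates\<close>

text \<open>Monotone convergence along \<open>[c, c + i]\<close> leads from gauge integrals over
  compact intervals to Lebesgue integrability on the half-line.\<close>

lemma set_integrable_atLeast_if_bounded:
  fixes g :: "real \<Rightarrow> real"
  assumes g: "continuous_on {c..} g" "\<And>s. s \<ge> c \<Longrightarrow> 0 \<le> g s"
    and C: "\<And>R. R \<ge> c \<Longrightarrow> integral {c..R} g \<le> C"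
  shows "set_integrable lborel {c..} g"
proof -
  have cg: "continuous_on {c..R} g" for R using g(1) by (rule continuous_on_subset) auto
  have meas: "(\<lambda>s. indicator {c..} s *\<^sub>R g s) \<in> borel_measurable borel"
    by (intro borel_measurable_continuous_on_indicator g) auto
  show ?thesis
    unfolding set_integrable_def
  proof (rule integrable_monotone_convergence[where f = "\<lambda>i s. indicator {c..c + real i} s *\<^sub>R g s"])
    have int: "set_integrable lborel {c..c + real i} g" for i
      by (intro borel_integrable_atLeastAtMost' cg)
    then show "integrable lborel (\<lambda>s. indicator {c..c + real i} s *\<^sub>R g s)" for i
      by (simp add: set_integrable_def)
    show "AE s in lborel. mono (\<lambda>i. indicator {c..c + real i} s *\<^sub>R g s)"
      using g(2) by (intro AE_I2) (auto simp: mono_def split: split_indicator)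
    show "AE s in lborel. (\<lambda>i. indicator {c..c + real i} s *\<^sub>R g s) \<longlonglongrightarrow> indicator {c..} s *\<^sub>R g s"
    proof (intro AE_I2 tendsto_eventually)
      fix s
      obtain k where k: "s - c \<le> real k" using real_arch_simple by blast
      show "\<forall>\<^sub>F i in sequentially. indicator {c..c + real i} s *\<^sub>R g s = indicator {c..} s *\<^sub>R g s"
        using eventually_ge_at_top[of k]
      proof eventually_elim
        case (elim i)
        then have "real k \<le> real i" by simp
        with k show ?case by (auto split: split_indicator)
      qed
    qed
    have eq: "(LINT s|lborel. indicator {c..c + real i} s *\<^sub>R g s) = integral {c..c + real i} g" for i
      using set_borel_integral_eq_integral(2)[OF int[of i]] by (simp add: set_lebesgue_integral_def)
    have "incseq (\<lambda>i. integral {c..c + real i} g)"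
      using g(2) by (auto intro!: incseq_SucI integral_subset_le integrable_continuous_interval cg)
    then obtain L where "(\<lambda>i. integral {c..c + real i} g) \<longlonglongrightarrow> L"
      by (rule incseq_convergent[of _ C]) (simp_all add: C)
    then have "convergent (\<lambda>i. integral {c..c + real i} g)" by (rule convergentI)
    then show "(\<lambda>i. LINT s|lborel. indicator {c..c + real i} s *\<^sub>R g s)
        \<longlonglongrightarrow> lim (\<lambda>i. integral {c..c + real i} g)"
      unfolding eq by (simp add: convergent_LIMSEQ_iff)
    show "(\<lambda>s. indicator {c..} s *\<^sub>R g s) \<in> borel_measurable lborel" using meas by simp
  qed
qed

lemma integral_powr_le:
  fixes c \<delta> :: real
  assumes "0 < c" "c \<le> R" "0 < \<delta>"
  shows "integral {c..R} (\<lambda>s. s powr (- 1 - \<delta>)) \<le> c powr (- \<delta>) / \<delta>"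
proof -
  have "((\<lambda>s. s powr (- 1 - \<delta>)) has_integral (- (R powr (- \<delta>) / \<delta>) - (- (c powr (- \<delta>) / \<delta>)))) {c..R}"
  proof (rule fundamental_theorem_of_calculus[OF assms(2)])
    fix s assume "s \<in> {c..R}"
    then have "s > 0" using assms by auto
    from DERIV_cmult[OF has_real_derivative_powr[OF this, of "- \<delta>"], of "- 1 / \<delta>"] assms(3)
    have "((\<lambda>s. - (s powr (- \<delta>) / \<delta>)) has_real_derivative s powr (- \<delta> - 1)) (at s)"
      by simp
    moreover have "- \<delta> - 1 = - 1 - \<delta>" by simp
    ultimately have "((\<lambda>s. - (s powr (- \<delta>) / \<delta>)) has_real_derivative s powr (- 1 - \<delta>)) (at s)"
      by metis
    then show "((\<lambda>s. - (s powr (- \<delta>) / \<delta>)) has_vector_derivative s powr (- 1 - \<delta>)) (at s within {c..R})"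
      by (simp add: has_real_derivative_iff_has_vector_derivative has_vector_derivative_at_within)
  qed
  from integral_unique[OF this] assms show ?thesis by simp
qed

text \<open>The tangent at \<open>x = m\<close> of \<open>x powr q\<close>, regarded as a convex
  function of \<open>1 / x^2\<close>. Integrated, it converts an upper bound for the integral of
  \<open>1 / W^2\<close> into a lower bound for that of \<open>\<bar>W\<bar> powr q\<close>, in the
  manner of Jensen's inequality.\<close>

lemma powr_ge_tangent:
  fixes x m q :: real
  assumes "x > 0" "m > 0" "q \<ge> 0"
  shows "m powr q * ((1 + q / 2) - q / 2 * m\<^sup>2 / x\<^sup>2) \<le> x powr q"
proof -
  have z: "(m / x)\<^sup>2 > 0" using assms by simp
  have "1 + q / 2 - q / 2 * (m / x)\<^sup>2 \<le> 1 - q / 2 * ln ((m / x)\<^sup>2)"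
    using mult_left_mono[OF ln_le_minus_one[OF z], of "q / 2"] assms(3) by (simp add: algebra_simps)
  also have "\<dots> = 1 + q * (ln x - ln m)"
    using assms by (simp add: ln_realpow ln_div algebra_simps)
  also have "\<dots> \<le> exp (q * (ln x - ln m))" by (rule exp_ge_add_one_self)
  also have "\<dots> = x powr q / m powr q"
    using assms by (simp add: powr_def exp_diff[symmetric] algebra_simps)
  finally have "m powr q * (1 + q / 2 - q / 2 * (m / x)\<^sup>2) \<le> m powr q * (x powr q / m powr q)"
    using assms by (intro mult_left_mono) auto
  then show ?thesis using assms by (simp add: power_divide)
qed

text \<open>By dominated convergence the integrals of an integrable function over
  \<open>[i, 2 * i]\<close> tend to 0.\<close>

lemma not_integrable_if_dyadic_lower_bound:
  fixes G :: "real \<Rightarrow> real"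
  assumes c: "c > 0" and low: "\<And>r. r \<ge> t \<Longrightarrow> c \<le> (LINT s:{r..2 * r}|lborel. G s)"
  shows "\<not> integrable lborel G"
proof
  assume G: "integrable lborel G"
  have "(\<lambda>i. LINT s|lborel. indicator {real i..2 * real i} s *\<^sub>R G s) \<longlonglongrightarrow> (LINT s|(lborel :: real measure). 0)"
  proof (rule integral_dominated_convergence[where w = "\<lambda>s. norm (G s)"])
    show "integrable lborel (\<lambda>s. norm (G s))" using G by simp
    show "(\<lambda>s. indicator {real i..2 * real i} s *\<^sub>R G s) \<in> borel_measurable lborel" for i
      using G by measurable
    show "AE s in lborel. (\<lambda>i. indicator {real i..2 * real i} s *\<^sub>R G s) \<longlonglongrightarrow> 0"
    proof (intro AE_I2 tendsto_eventually)
      fix s :: real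
      obtain k where k: "s < real k" using reals_Archimedean2 by blast
      show "\<forall>\<^sub>F i in sequentially. indicator {real i..2 * real i} s *\<^sub>R G s = 0"
        using eventually_ge_at_top[of k]
      proof eventually_elim
        case (elim i)
        then have "real k \<le> real i" by simp
        with k show ?case by auto
      qed
    qed
    show "AE s in lborel. norm (indicator {real i..2 * real i} s *\<^sub>R G s) \<le> norm (G s)" for i
      by (intro AE_I2) (auto split: split_indicator)
  qed auto
  then have "(\<lambda>i. LINT s:{real i..2 * real i}|lborel. G s) \<longlonglongrightarrow> 0"
    by (simp add: set_lebesgue_integral_def)
  moreover obtain k where k: "t \<le> real k" using real_arch_simple by blast
  have "\<forall>i\<ge>k. c \<le> (LINT s:{real i..2 * real i}|lborel. G s)"
  proof (intro allI impI low)
    fix i assume "k \<le> i"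
    then have "real k \<le> real i" by simp
    with k show "t \<le> real i" by simp
  qed
  ultimately have "c \<le> 0" using LIMSEQ_le_const by blast
  with c show False by simp
qed

subsection \<open>Decay of the radial profile\<close>

text \<open>The interface between the differential equation and the asymptotics: \<open>n\<close> is
  \<open>N - 1\<close>, one constant \<open>B\<close> serves for both bounds, and stability enters
  through \<open>weight\<close>.\<close>

locale radial_profile =
  fixes U W V :: "real \<Rightarrow> real" and n :: nat and B :: real
  assumes dU: "\<And>r. r > 1 \<Longrightarrow> (U has_real_derivative W r) (at r)"
    and dW: "\<And>r. r > 1 \<Longrightarrow> (W has_real_derivative V r) (at r)"
    and V_cont: "continuous_on {1<..} V"
    and n: "n \<ge> 2"
    and U_bdd: "\<And>r. r \<ge> 1 \<Longrightarrow> \<bar>U r\<bar> \<le> B" and W_bdd: "\<And>r. r > 1 \<Longrightarrow> \<bar>W r\<bar> \<le> B"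
    and weight: "stable_weight (\<lambda>r. r ^ n * (W r)\<^sup>2) (real n)"
begin

abbreviation p where "p \<equiv> \<lambda>r. r ^ n * (W r)\<^sup>2"

definition y where "y = sqrt (real n)"

lemma y: "y > 1" "y\<^sup>2 = real n" using n by (simp_all add: y_def)

lemma W_cont: "continuous_on {1<..} W"
  using DERIV_continuous_on_greaterThan[OF dW] .

lemma W_cont': "1 < a \<Longrightarrow> continuous_on {a..b} W"
  using W_cont by (rule continuous_on_subset) auto

lemma B_nonneg: "0 \<le> B" using U_bdd[of 1] by linarith

text \<open>If zeros occur arbitrarily far out, every \<open>s\<close> beyond a zero
  \<open>r1\<close> lies between two zeros of \<open>W\<close>. As \<open>W\<close> is Lipschitz on
  compact intervals, \<open>p\<close> has double zeros there, and
  \<open>vanish_between_zeros\<close> applies.\<close>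

lemma eventually_zero_or_nonzero:
  "(\<exists>a>1. \<forall>r\<ge>a. W r = 0) \<or> (\<exists>a>1. \<forall>r\<ge>a. W r \<noteq> 0)"
proof (rule disjCI)
  assume "\<not> (\<exists>a>1. \<forall>r\<ge>a. W r \<noteq> 0)"
  then have ex: "\<exists>r\<ge>a. W r = 0" if "a > 1" for a using that by blast
  then obtain r1 where r1: "r1 \<ge> 2" "W r1 = 0" by (meson one_less_numeral_iff semiring_norm(76))
  have "W s = 0" if s: "s > r1" for s
  proof -
    obtain r2 where r2: "r2 \<ge> s + 1" "W r2 = 0" using ex[of "s + 1"] s r1 by auto
    have "continuous_on {r1..r2} V" using V_cont by (rule continuous_on_subset) (use r1 in auto)
    then obtain k where k0: "k > 0" and k: "\<And>t. t \<in> {r1..r2} \<Longrightarrow> \<bar>V t\<bar> \<le> k"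
      using compact_imp_bounded[OF compact_continuous_image[of "{r1..r2}" V]] unfolding bounded_pos
      by auto
    have lip: "\<bar>W t - W t'\<bar> \<le> k * \<bar>t - t'\<bar>" if "t \<in> {r1..r2}" "t' \<in> {r1..r2}" for t t'
    proof -
      have "norm (W t - W t') \<le> k * norm (t - t')"
        by (rule field_differentiable_bound[of "{r1..r2}" W V])
          (use that k r1 dW in \<open>auto intro: has_field_derivative_at_within\<close>)
      then show ?thesis by simp
    qed
    have bd: "p t \<le> r2 ^ n * k\<^sup>2 * d\<^sup>2" if "t \<in> {r1..r2}" "\<bar>W t\<bar> \<le> k * \<bar>d\<bar>" for t d
    proof -
      have "(W t)\<^sup>2 \<le> (k * \<bar>d\<bar>)\<^sup>2" using that(2) by (metis abs_ge_zero power2_abs power_mono)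
      then have "t ^ n * (W t)\<^sup>2 \<le> r2 ^ n * (k * \<bar>d\<bar>)\<^sup>2"
        using that(1) r1 by (intro mult_mono[OF power_mono]) auto
      then show ?thesis by (simp add: power_mult_distrib mult.assoc)
    qed
    have "p s = 0"
    proof (rule stable_weight.vanish_between_zeros[OF weight, where ?r1.0 = r1 and ?r2.0 = r2
          and K = "r2 ^ n * k\<^sup>2"])
      fix t assume t: "t \<in> {r1..r2}"
      show "p t \<le> r2 ^ n * k\<^sup>2 * (t - r1)\<^sup>2"
        by (rule bd[OF t]) (use lip[OF t, of r1] t r1 in auto)
      show "p t \<le> r2 ^ n * k\<^sup>2 * (r2 - t)\<^sup>2"
        by (rule bd[OF t]) (use lip[OF t, of r2] t r2 in \<open>auto simp: abs_minus_commute\<close>)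
    qed (use r1 r2 s in auto)
    then show ?thesis using s r1 by simp
  qed
  then show "\<exists>a>1. \<forall>r\<ge>a. W r = 0" using r1 by (intro exI[of _ "r1 + 1"]) auto
qed

lemma W_has_integral:
  assumes "1 < r" "r \<le> R"
  shows "(W has_integral (U R - U r)) {r..R}"
  by (rule fundamental_theorem_of_calculus[OF assms(2)])
    (use assms dU in \<open>auto simp: has_real_derivative_iff_has_vector_derivative[symmetric]
       intro: has_field_derivative_at_within\<close>)

text \<open>With \<open>N = n + 1\<close> the exponents are
  \<open>- N / 2 - sqrt (N - 1) + 2\<close> and \<open>N / 2 + sqrt (N - 1) - 1\<close>; the
  integrand is the \<open>q\<close>-th power of the gradient in polar coordinates, up to a
  constant.\<close>

definition fast where
  "fast l \<longleftrightarrow> (\<exists>M>0. \<forall>r\<ge>1. \<bar>U r - l\<bar> \<le> M * r powr (3 / 2 - real n / 2 - y)) \<and>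
    (\<forall>q>0. real n + 1 < q * (real n / 2 - 1 / 2 + y) \<longrightarrow>
       integrable lborel (\<lambda>r. r ^ n * (indicator {1<..} r * \<bar>W r\<bar> powr q)))"

text \<open>The range of \<open>q\<close> is stated as a product because the sign of
  \<open>n / 2 - 1 / 2 - y\<close> is settled only later, when the lower bound has forced a negative
  exponent.\<close>

definition slow where
  "slow l \<longleftrightarrow> (\<exists>M>0. \<exists>r0\<ge>1. \<forall>r\<ge>r0. M * r powr (3 / 2 - real n / 2 + y) \<le> \<bar>U r - l\<bar>) \<and>
    (\<forall>q>0. q * (real n / 2 - 1 / 2 - y) \<le> real n + 1 \<longrightarrow>
       \<not> integrable lborel (\<lambda>r. r ^ n * (indicator {1<..} r * \<bar>W r\<bar> powr q)))"

lemma upper_bound_from_one: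
  assumes "c > 1" "e \<le> 0" "\<bar>l\<bar> \<le> B" "M > 0"
    and M: "\<And>r. r \<ge> c \<Longrightarrow> \<bar>U r - l\<bar> \<le> M * r powr e"
  shows "\<exists>M>0. \<forall>r\<ge>1. \<bar>U r - l\<bar> \<le> M * r powr e"
\<comment> \<open>On \<open>[1, c)\<close> the difference is at most \<open>2 * B\<close>, and
  \<open>r powr e \<ge> c powr e\<close> because \<open>e \<le> 0\<close>.\<close>
proof (intro exI[of _ "max M (2 * B * c powr (- e))"] conjI allI impI)
  fix r :: real assume r: "r \<ge> 1"
  show "\<bar>U r - l\<bar> \<le> max M (2 * B * c powr (- e)) * r powr e"
  proof (cases "r \<ge> c")
    case True
    have "M * r powr e \<le> max M (2 * B * c powr (- e)) * r powr e"
      by (intro mult_right_mono) auto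
    with M[OF True] show ?thesis by linarith
  next
    case False
    have "c powr (- e) * c powr e = 1" using assms by (simp add: powr_add[symmetric])
    then have "2 * B = 2 * B * c powr (- e) * c powr e" by simp
    also have "\<dots> \<le> 2 * B * c powr (- e) * r powr e"
      using B_nonneg False r assms by (intro mult_left_mono powr_mono2') auto
    also have "\<dots> \<le> max M (2 * B * c powr (- e)) * r powr e" by (intro mult_right_mono) auto
    finally have "2 * B \<le> max M (2 * B * c powr (- e)) * r powr e" .
    moreover have "\<bar>U r - l\<bar> \<le> 2 * B" using U_bdd[OF r] assms by linarith
    ultimately show ?thesis by linarith
  qed
qed (use assms in auto)

lemma power_W_measurable: "(\<lambda>r. r ^ n * (indicator {1<..} r * \<bar>W r\<bar> powr q)) \<in> borel_measurable borel"
proof -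
  have "(\<lambda>r. indicator {1<..} r *\<^sub>R W r) \<in> borel_measurable borel"
    by (intro borel_measurable_continuous_on_indicator W_cont) auto
  then have "(\<lambda>r. r ^ n * (indicator {1<..} r * \<bar>indicator {1<..} r *\<^sub>R W r\<bar> powr q)) \<in> borel_measurable borel"
    by measurable
  also have "(\<lambda>r. r ^ n * (indicator {1<..} r * \<bar>indicator {1<..} r *\<^sub>R W r\<bar> powr q))
      = (\<lambda>r. r ^ n * (indicator {1<..} r * \<bar>W r\<bar> powr q))"
    by (auto split: split_indicator)
  finally show ?thesis .
qed

text \<open>On \<open>(1, c]\<close> the integrand is bounded because \<open>W\<close> is, so that
  only the tail matters.\<close>

lemma integrable_if_tail_integrable:
  assumes "c > 1" "q > 0" "set_integrable lborel {c..} (\<lambda>r. r ^ n * \<bar>W r\<bar> powr q)"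
  shows "integrable lborel (\<lambda>r. r ^ n * (indicator {1<..} r * \<bar>W r\<bar> powr q))"
proof -
  let ?g = "\<lambda>r. r ^ n * (indicator {1<..} r * \<bar>W r\<bar> powr q)"
  have 1: "set_integrable lborel {1..c} ?g"
    unfolding set_integrable_def
  proof (rule integrableI_bounded_set_indicator[where B = "c ^ n * B powr q"])
    show "?g \<in> borel_measurable lborel" using power_W_measurable[of q] by simp
    show "AE r in lborel. r \<in> {1..c} \<longrightarrow> norm (?g r) \<le> c ^ n * B powr q"
    proof (intro AE_I2 impI)
      fix r assume r: "r \<in> {1..c}"
      show "norm (?g r) \<le> c ^ n * B powr q"
      proof (cases "r > 1")
        case True
        then have "r ^ n * \<bar>W r\<bar> powr q \<le> c ^ n * B powr q"
          using W_bdd[of r] r assms by (intro mult_mono power_mono powr_mono2) auto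
        with True show ?thesis by (auto simp: abs_mult)
      qed (use assms in auto)
    qed
    show "emeasure lborel {1..c} < \<infinity>" using assms by simp
  qed auto
  have "set_integrable lborel {c..} ?g"
    using assms(3) by (rule set_integrable_cong[THEN iffD1, rotated -1]) (use assms in auto)
  with 1 have "set_integrable lborel ({1..c} \<union> {c..}) ?g"
    by (intro set_integrable_Un) auto
  moreover have "{1..c} \<union> {c..} = {1..}" using assms by auto
  ultimately have "integrable lborel (\<lambda>r. indicator {1..} r *\<^sub>R ?g r)"
    by (simp add: set_integrable_def)
  also have "(\<lambda>r. indicator {1..} r *\<^sub>R ?g r) = ?g" by (auto split: split_indicator)
  finally show ?thesis .
qed

lemma fast_if_eventually_zero:
  assumes a: "a > 1" "\<And>r. r \<ge> a \<Longrightarrow> W r = 0"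
  shows "\<exists>l. (U \<longlongrightarrow> l) at_top \<and> fast l"
proof -
  have const: "U r = U a" if "r \<ge> a" for r
  proof -
    have "(W has_integral 0) {a..r}" by (rule has_integral_is_0) (use a in auto)
    from has_integral_unique[OF W_has_integral[OF a(1) that] this] show ?thesis by simp
  qed
  have "(U \<longlongrightarrow> U a) at_top"
    using eventually_mono[OF eventually_ge_at_top[of a] const] by (rule tendsto_eventually)
  moreover have "\<exists>M>0. \<forall>r\<ge>1. \<bar>U r - U a\<bar> \<le> M * r powr (3 / 2 - real n / 2 - y)"
  proof (rule upper_bound_from_one[of a _ _ 1])
    show "\<bar>U r - U a\<bar> \<le> 1 * r powr (3 / 2 - real n / 2 - y)" if "r \<ge> a" for r
      by (subst const[OF that]) simp
  qed (use a n y U_bdd[of a] in auto)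
  moreover have "integrable lborel (\<lambda>r. r ^ n * (indicator {1<..} r * \<bar>W r\<bar> powr q))" if "q > 0" for q
  proof (rule integrable_if_tail_integrable[OF a(1) that])
    have "(\<lambda>r. indicator {a..} r *\<^sub>R (r ^ n * \<bar>W r\<bar> powr q)) = (\<lambda>_. 0)"
      using a by (auto split: split_indicator)
    then show "set_integrable lborel {a..} (\<lambda>r. r ^ n * \<bar>W r\<bar> powr q)"
      by (simp add: set_integrable_def)
  qed
  ultimately show ?thesis by (auto simp: fast_def)
qed

end

lemma continuous_nonzero_sign:
  fixes g :: "real \<Rightarrow> real"
  assumes "continuous_on {a..} g" "\<And>r. r \<ge> a \<Longrightarrow> g r \<noteq> 0"
  obtains \<sigma> :: real where "\<sigma> = 1 \<or> \<sigma> = -1" "\<And>r. r \<ge> a \<Longrightarrow> \<sigma> * g r = \<bar>g r\<bar>"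
proof -
  have conn: "connected (g ` {a..})"
    using assms(1) by (intro connected_continuous_image) auto
  have "sgn (g a) * g r = \<bar>g r\<bar>" if r: "r \<ge> a" for r
  proof (rule ccontr)
    assume "sgn (g a) * g r \<noteq> \<bar>g r\<bar>"
    then have "g a < 0 \<and> 0 < g r \<or> g r < 0 \<and> 0 < g a"
      using assms(2)[of a] assms(2)[OF r] by (auto simp: sgn_if split: if_splits)
    then have "0 \<in> g ` {a..}"
      using connectedD_interval[OF conn, of "g a" "g r" 0] connectedD_interval[OF conn, of "g r" "g a" 0] r
      by auto
    then show False using assms(2) by auto
  qed
  moreover have "sgn (g a) = 1 \<or> sgn (g a) = -1" using assms(2)[of a] by (auto simp: sgn_if)
  ultimately show ?thesis using that by blast
qed

section \<open>Profiles whose derivative has no zeros near infinity\<close>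

context radial_profile
begin

context
  fixes a :: real
  assumes a: "a > 1" and W_nz: "\<And>r. r \<ge> a \<Longrightarrow> W r \<noteq> 0"
begin

lemma p_pos: "r \<ge> a \<Longrightarrow> 0 < p r"
  using a W_nz[of r] by simp

lemma abs_W_powr_cont: "a \<le> c \<Longrightarrow> continuous_on {c..} (\<lambda>s. s ^ n * \<bar>W s\<bar> powr q)"
  using a W_nz by (intro continuous_intros continuous_on_subset[OF W_cont]) auto

lemma abs_W_powr_cont': "a \<le> c \<Longrightarrow> continuous_on {c..d} (\<lambda>s. \<bar>W s\<bar> powr q)"
  using a W_nz by (intro continuous_intros continuous_on_subset[OF W_cont]) auto

text \<open>Beyond \<open>a\<close> the derivative \<open>W\<close> keeps one sign
  \<open>\<sigma>\<close>, so \<open>\<sigma> * U\<close> increases and is bounded. Carrying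
  \<open>\<sigma>\<close> along handles increasing and decreasing profiles at once.\<close>

lemma monotone_limit:
  obtains \<sigma> l where "\<sigma> = 1 \<or> \<sigma> = -1" "(U \<longlongrightarrow> l) at_top" "\<bar>l\<bar> \<le> B"
    "\<And>r R. a \<le> r \<Longrightarrow> r \<le> R \<Longrightarrow> ((\<lambda>s. \<bar>W s\<bar>) has_integral \<sigma> * (U R - U r)) {r..R}"
    "\<And>r. a \<le> r \<Longrightarrow> \<sigma> * U r \<le> \<sigma> * l"
proof -
  have "continuous_on {a..} W" using W_cont by (rule continuous_on_subset) (use a in auto)
  then obtain \<sigma> where \<sigma>: "\<sigma> = 1 \<or> \<sigma> = -1" and sW: "\<And>r. r \<ge> a \<Longrightarrow> \<sigma> * W r = \<bar>W r\<bar>"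
    using continuous_nonzero_sign[of a W] W_nz by blast
  have int: "((\<lambda>s. \<bar>W s\<bar>) has_integral \<sigma> * (U R - U r)) {r..R}" if r: "a \<le> r" "r \<le> R" for r R
  proof (rule has_integral_eq)
    show "((\<lambda>s. \<sigma> * W s) has_integral \<sigma> * (U R - U r)) {r..R}"
      using W_has_integral[of r R] a r by (intro has_integral_mult_right) auto
    show "\<sigma> * W s = \<bar>W s\<bar>" if "s \<in> {r..R}" for s using that r sW by auto
  qed
  have mono: "\<sigma> * U r \<le> \<sigma> * U R" if "a \<le> r" "r \<le> R" for r R
    using has_integral_nonneg[OF int[OF that]] by (simp add: algebra_simps)
  \<comment> \<open>Frozen to the left of \<open>a\<close>, so that \<open>h\<close> is monotone on
    the whole line and its limit can be found along the integers.\<close>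
  define h where "h r = \<sigma> * U (max a r)" for r
  have "mono h" by (rule monoI) (auto simp: h_def intro!: mono)
  have hB: "h r \<le> B" for r
    using U_bdd[of "max a r"] a \<sigma> by (auto simp: h_def abs_le_iff)
  have "incseq (\<lambda>i. h (real i))" using \<open>mono h\<close> by (auto simp: incseq_def mono_def)
  then obtain L where "(\<lambda>i. h (real i)) \<longlonglongrightarrow> L"
    by (rule incseq_convergent[of _ B]) (simp_all add: hB)
  then have hL: "(h \<longlongrightarrow> L) at_top"
    using \<open>mono h\<close> by (intro tendsto_at_topI_sequentially_real)
  have "((\<lambda>r. \<sigma> * h r) \<longlongrightarrow> \<sigma> * L) at_top" using hL by (intro tendsto_mult_left)
  moreover have "\<forall>\<^sub>F r in at_top. \<sigma> * h r = U r"
    using eventually_ge_at_top[of a]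
    by eventually_elim (use \<sigma> in \<open>auto simp: h_def max_absorb2\<close>)
  ultimately have lim: "(U \<longlongrightarrow> \<sigma> * L) at_top" by (rule Lim_transform_eventually)
  have "((\<lambda>r. \<bar>U r\<bar>) \<longlongrightarrow> \<bar>\<sigma> * L\<bar>) at_top" using lim by (intro tendsto_intros)
  moreover have "\<forall>\<^sub>F r in at_top. \<bar>U r\<bar> \<le> B"
    using eventually_ge_at_top[of 1] by eventually_elim (rule U_bdd)
  ultimately have "\<bar>\<sigma> * L\<bar> \<le> B" by (rule tendsto_upperbound) simp
  moreover have "\<sigma> * U r \<le> \<sigma> * (\<sigma> * L)" if r: "a \<le> r" for r
  proof -
    have "((\<lambda>R. \<sigma> * U R) \<longlongrightarrow> \<sigma> * (\<sigma> * L)) at_top" using lim by (intro tendsto_mult_left)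
    moreover have "\<forall>\<^sub>F R in at_top. \<sigma> * U r \<le> \<sigma> * U R"
      using eventually_ge_at_top[of r] by eventually_elim (use mono r in auto)
    ultimately show ?thesis by (rule tendsto_lowerbound) simp
  qed
  ultimately show ?thesis using that[of \<sigma> "\<sigma> * L"] \<sigma> lim int by blast
qed

text \<open>The mean decay of \<open>p\<close>, with \<open>\<alpha> = 1\<close>, bounds increments
  of \<open>U\<close> in the manner of Cauchy-Schwarz against \<open>s ^ n\<close>. Integrability
  for \<open>q < 2\<close> uses an exponent \<open>\<alpha>\<close> closer to \<open>y\<close>,
  chosen according to \<open>q\<close>.\<close>

lemma fast_if_inverse_unbounded:
  assumes unbdd: "\<And>K. \<exists>T>a. integral {a..T} (\<lambda>r. 1 / p r) > K"
  shows "\<exists>l. (U \<longlongrightarrow> l) at_top \<and> fast l"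
proof -
  define c where "c = a + 1"
  have c: "c > 1" "a \<le> c" using a by (auto simp: c_def)
  obtain \<sigma> l where \<sigma>: "\<sigma> = 1 \<or> \<sigma> = -1" and lim: "(U \<longlongrightarrow> l) at_top" and l: "\<bar>l\<bar> \<le> B"
    and int: "\<And>r R. a \<le> r \<Longrightarrow> r \<le> R \<Longrightarrow> ((\<lambda>s. \<bar>W s\<bar>) has_integral \<sigma> * (U R - U r)) {r..R}"
    and le: "\<And>r. a \<le> r \<Longrightarrow> \<sigma> * U r \<le> \<sigma> * l"
    using monotone_limit by blast
  have decay: "\<exists>C>0. \<forall>r R. c \<le> r \<longrightarrow> r \<le> R \<longrightarrow>
      integral {r..R} (\<lambda>s. p s * s powr (2 * \<alpha> - 2)) \<le> C * r powr (2 * \<alpha> - 2 * y)" if "\<bar>\<alpha>\<bar> < y" for \<alpha>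
    using stable_weight.decay_of_inverse_unbounded[OF weight a p_pos unbdd, of \<alpha>] that
    by (simp add: c_def y_def)
  \<comment> \<open>The exponent \<open>\<alpha> = 1\<close> is admissible because
    \<open>y > 1\<close>; it turns the weight \<open>s powr (2 * \<alpha> - 2)\<close> into
    1.\<close>
  obtain C where C: "C > 0" and C1: "\<And>r R. c \<le> r \<Longrightarrow> r \<le> R \<Longrightarrow> integral {r..R} p \<le> C * r powr (2 - 2 * y)"
  proof -
    obtain C where C: "C > 0" "\<And>r R. c \<le> r \<Longrightarrow> r \<le> R \<Longrightarrow>
        integral {r..R} (\<lambda>s. p s * s powr (2 * 1 - 2)) \<le> C * r powr (2 * 1 - 2 * y)"
      using decay[of 1] y(1) by auto
    have "integral {r..R} (\<lambda>s. p s * s powr (2 * 1 - 2)) = integral {r..R} p" if "c \<le> r" for r R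
      by (rule Henstock_Kurzweil_Integration.integral_cong) (use that c in auto)
    with C show ?thesis using that[of C] by auto
  qed
  have pint: "p integrable_on {r..R}" if "c \<le> r" for r R
    using c that by (intro integrable_continuous_interval continuous_intros W_cont') auto
  define e where "e = 3 / 2 - real n / 2 - y"
  define M where "M = (C + 1 / (real n - 1)) / 2"
  have M: "M > 0" using C n by (simp add: M_def add_pos_nonneg)
  have dU: "\<bar>U R - U r\<bar> \<le> M * r powr e" if r: "c \<le> r" "r \<le> R" for r R
  proof -
    have r0: "r > 0" using r c by auto
    \<comment> \<open>Weight for \<open>2 * \<bar>W\<bar> \<le> k * p + 1 / (k * s ^ n)\<close>,
      balanced so that the integrals of both terms are at most multiples of
      \<open>r powr e\<close>.\<close>
    define k where "k = r powr (y - (1 + real n) / 2)"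
    have k: "k > 0" using r0 by (simp add: k_def)
    have "\<sigma> * (U R - U r) \<le> (k * integral {r..R} p + integral {r..R} (\<lambda>s. s powr (- 1 - (real n - 1))) / k) / 2"
    proof (rule has_integral_le)
      show "((\<lambda>s. \<bar>W s\<bar>) has_integral \<sigma> * (U R - U r)) {r..R}" using int c r by auto
      have "(\<lambda>s. s powr (- 1 - (real n - 1))) integrable_on {r..R}"
        using r0 by (intro integrable_continuous_interval continuous_intros) auto
      then show "((\<lambda>s. (k * p s + s powr (- 1 - (real n - 1)) / k) / 2) has_integral
          (k * integral {r..R} p + integral {r..R} (\<lambda>s. s powr (- 1 - (real n - 1))) / k) / 2) {r..R}"
        using pint[OF r(1)]
        by (intro has_integral_divide has_integral_add has_integral_mult_right integrable_integral)
      fix s assume s: "s \<in> {r..R}"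
      then have s0: "s > 0" using r0 by auto
      define P where "P = s ^ n"
      have P: "P > 0" using s0 by (simp add: P_def)
      have "s powr (- 1 - (real n - 1)) = 1 / P"
        using s0 by (simp add: P_def powr_minus powr_realpow divide_inverse)
      moreover have "0 \<le> (k * P * \<bar>W s\<bar> - 1)\<^sup>2 / (k * P)" using k P by simp
      then have "2 * \<bar>W s\<bar> \<le> k * (P * (W s)\<^sup>2) + 1 / P / k"
        using k P by (simp add: power2_eq_square field_simps)
      ultimately show "\<bar>W s\<bar> \<le> (k * p s + s powr (- 1 - (real n - 1)) / k) / 2"
        by (simp add: P_def)
    qed
    also have "\<dots> \<le> (k * (C * r powr (2 - 2 * y)) + r powr (- (real n - 1)) / (real n - 1) / k) / 2"
      using C1[OF r] integral_powr_le[OF r0 r(2), of "real n - 1"] k n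
      by (intro divide_right_mono add_mono mult_left_mono) auto
    also have "k * (C * r powr (2 - 2 * y)) = C * r powr e"
      using r0 by (simp add: k_def e_def powr_add[symmetric] field_simps)
    also have "r powr (- (real n - 1)) / (real n - 1) / k = 1 / (real n - 1) * (r powr (- (real n - 1)) / k)"
      by simp
    also have "r powr (- (real n - 1)) / k = r powr (- (real n - 1) - (y - (1 + real n) / 2))"
      by (simp only: k_def powr_diff)
    also have "- (real n - 1) - (y - (1 + real n) / 2) = e" by (simp add: e_def field_simps)
    also have "(C * r powr e + 1 / (real n - 1) * r powr e) / 2 = M * r powr e"
      by (simp add: M_def algebra_simps)
    finally have "\<sigma> * (U R - U r) \<le> M * r powr e" .
    moreover have "0 \<le> \<sigma> * (U R - U r)"
      using has_integral_nonneg[OF int[of r R]] c r by auto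
    ultimately show ?thesis using \<sigma> by auto
  qed
  have Ul: "\<bar>U r - l\<bar> \<le> M * r powr e" if r: "r \<ge> c" for r
  proof -
    have "((\<lambda>R. \<bar>U R - U r\<bar>) \<longlongrightarrow> \<bar>l - U r\<bar>) at_top" using lim by (intro tendsto_intros)
    moreover have "\<forall>\<^sub>F R in at_top. \<bar>U R - U r\<bar> \<le> M * r powr e"
      using eventually_ge_at_top[of r] by eventually_elim (rule dU[OF r])
    ultimately have "\<bar>l - U r\<bar> \<le> M * r powr e" by (rule tendsto_upperbound) simp
    then show ?thesis by (simp add: abs_minus_commute)
  qed
  have "integrable lborel (\<lambda>r. r ^ n * (indicator {1<..} r * \<bar>W r\<bar> powr q))"
    if q: "q > 0" "real n + 1 < q * (real n / 2 - 1 / 2 + y)" for q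
  proof (rule integrable_if_tail_integrable[OF c(1) q(1)])
    let ?g = "\<lambda>s. s ^ n * \<bar>W s\<bar> powr q"
    have gint: "?g integrable_on {c..R}" for R
      by (intro integrable_continuous_interval continuous_on_subset[OF abs_W_powr_cont[OF c(2)]]) auto
    have "\<exists>K. \<forall>R\<ge>c. integral {c..R} ?g \<le> K"
    proof (cases "q \<ge> 2")
      \<comment> \<open>For \<open>q \<ge> 2\<close> the bound on \<open>W\<close> reduces the claim
        to the integral of \<open>p\<close>.\<close>
      case True
      have "integral {c..R} ?g \<le> B powr (q - 2) * (C * c powr (2 - 2 * y))" if R: "R \<ge> c" for R
      proof -
        have "integral {c..R} ?g \<le> integral {c..R} (\<lambda>s. B powr (q - 2) * p s)"
        proof (intro integral_le gint integrable_on_mult_right pint)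
          fix s assume s: "s \<in> {c..R}"
          then have W: "W s \<noteq> 0" "\<bar>W s\<bar> \<le> B" using c W_nz W_bdd by auto
          have "\<bar>W s\<bar> powr q = \<bar>W s\<bar> powr (q - 2) * (W s)\<^sup>2"
            using W(1) powr_add[of "\<bar>W s\<bar>" "q - 2" 2] by simp
          also have "\<dots> \<le> B powr (q - 2) * (W s)\<^sup>2"
            using True W by (intro mult_right_mono powr_mono2) auto
          finally have "s ^ n * \<bar>W s\<bar> powr q \<le> s ^ n * (B powr (q - 2) * (W s)\<^sup>2)"
            using s c by (intro mult_left_mono) auto
          then show "?g s \<le> B powr (q - 2) * p s" by (simp add: mult_ac)
        qed auto
        also have "\<dots> = B powr (q - 2) * integral {c..R} p" by (rule integral_mult_right)
        also have "\<dots> \<le> B powr (q - 2) * (C * c powr (2 - 2 * y))"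
          using C1[OF order_refl R] by (intro mult_left_mono) auto
        finally show ?thesis .
      qed
      then show ?thesis by blast
    next
      case False
      \<comment> \<open>The assumption on \<open>q\<close> amounts to \<open>\<beta> < y\<close>, so
        the midpoint \<open>\<alpha>\<close> of \<open>max 0 \<beta>\<close> and \<open>y\<close>
        satisfies \<open>\<beta> < \<alpha> < y\<close>; this makes \<open>\<delta>\<close>
        positive.\<close>
      define \<beta> where "\<beta> = (real n + 1) / q - real n / 2 + 1 / 2"
      define \<alpha> where "\<alpha> = (max 0 \<beta> + y) / 2"
      have "(real n + 1) / q < real n / 2 - 1 / 2 + y"
        using q by (simp add: divide_less_eq mult.commute)
      then have "\<beta> < y" by (simp add: \<beta>_def)
      then have \<alpha>: "\<bar>\<alpha>\<bar> < y" "\<beta> < \<alpha>" using y(1) by (auto simp: \<alpha>_def)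
      define \<kappa> where "\<kappa> = real n / 2 - 1 / 2 + \<alpha>"
      define \<delta> where "\<delta> = \<kappa> * q - (real n + 1)"
      have "(real n + 1) / q < \<kappa>" using \<alpha>(2) by (simp add: \<beta>_def \<kappa>_def)
      then have \<delta>: "\<delta> > 0" using q(1) by (simp add: \<delta>_def divide_less_eq)
      obtain D where D: "\<And>r R. c \<le> r \<Longrightarrow> r \<le> R \<Longrightarrow>
          integral {r..R} (\<lambda>s. p s * s powr (2 * \<alpha> - 2)) \<le> D * r powr (2 * \<alpha> - 2 * y)"
        using decay[OF \<alpha>(1)] by blast
      have "integral {c..R} ?g \<le> D * c powr (2 * \<alpha> - 2 * y) + c powr (- \<delta>) / \<delta>" if R: "R \<ge> c" for R
      proof -
        have i1: "(\<lambda>s. p s * s powr (2 * \<alpha> - 2)) integrable_on {c..R}"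
          using c by (intro integrable_continuous_interval continuous_intros W_cont') auto
        have i2: "(\<lambda>s. s powr (- 1 - \<delta>)) integrable_on {c..R}"
          using c by (intro integrable_continuous_interval continuous_intros) auto
        have "integral {c..R} ?g \<le> integral {c..R} (\<lambda>s. p s * s powr (2 * \<alpha> - 2) + s powr (- 1 - \<delta>))"
        proof (intro integral_le gint integrable_add i1 i2)
          fix s assume "s \<in> {c..R}"
          then have s: "s > 1" "W s \<noteq> 0" using c W_nz by auto
          \<comment> \<open>Split at \<open>s powr (- \<kappa>)\<close>. Values of
            \<open>\<bar>W\<bar>\<close> up to the threshold contribute at most
            \<open>s powr (n - \<kappa> * q) = s powr (- 1 - \<delta>)\<close>; above it,
            \<open>q < 2\<close> gives \<open>\<bar>W\<bar> powr q \<le> W^2 * s powr (2 * \<alpha>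
            - 2 - \<delta>)\<close>.\<close>
          show "?g s \<le> p s * s powr (2 * \<alpha> - 2) + s powr (- 1 - \<delta>)"
          proof (cases "\<bar>W s\<bar> \<le> s powr (- \<kappa>)")
            case True
            have "s ^ n * \<bar>W s\<bar> powr q \<le> s powr real n * (s powr (- \<kappa>)) powr q"
              using s True q(1) by (intro mult_mono powr_mono2) (auto simp: powr_realpow)
            also have "\<dots> = s powr (- 1 - \<delta>)"
              using s by (simp add: powr_powr powr_add[symmetric] \<delta>_def)
            finally show ?thesis using s by (simp add: add_increasing)
          next
            case False
            have "\<bar>W s\<bar> powr q = (W s)\<^sup>2 * \<bar>W s\<bar> powr (q - 2)"
              using s powr_add[of "\<bar>W s\<bar>" "q - 2" 2] by simp
            also have "\<dots> \<le> (W s)\<^sup>2 * (s powr (- \<kappa>)) powr (q - 2)"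
              using \<open>\<not> q \<ge> 2\<close> False s by (intro mult_left_mono powr_mono2') auto
            also have "(s powr (- \<kappa>)) powr (q - 2) = s powr (- \<kappa> * (q - 2))"
              by (simp add: powr_powr)
            also have "- \<kappa> * (q - 2) = 2 * \<alpha> - 2 - \<delta>"
              by (simp add: \<delta>_def \<kappa>_def field_simps)
            also have "(W s)\<^sup>2 * s powr (2 * \<alpha> - 2 - \<delta>) \<le> (W s)\<^sup>2 * s powr (2 * \<alpha> - 2)"
              using s \<delta> by (intro mult_left_mono powr_mono) auto
            finally have "s ^ n * \<bar>W s\<bar> powr q \<le> s ^ n * ((W s)\<^sup>2 * s powr (2 * \<alpha> - 2))"
              using s by (intro mult_left_mono) auto
            then show ?thesis by (simp add: mult.assoc add_increasing2)
          qed
        qed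
        also have "\<dots> = integral {c..R} (\<lambda>s. p s * s powr (2 * \<alpha> - 2)) + integral {c..R} (\<lambda>s. s powr (- 1 - \<delta>))"
          by (intro Henstock_Kurzweil_Integration.integral_add i1 i2)
        also have "\<dots> \<le> D * c powr (2 * \<alpha> - 2 * y) + c powr (- \<delta>) / \<delta>"
          using D[OF order_refl R] integral_powr_le[OF _ R \<delta>] c by (intro add_mono) auto
        finally show ?thesis .
      qed
      then show ?thesis by blast
    qed
    then obtain K where "\<And>R. R \<ge> c \<Longrightarrow> integral {c..R} ?g \<le> K" by blast
    then show "set_integrable lborel {c..} ?g"
      using c by (intro set_integrable_atLeast_if_bounded abs_W_powr_cont) auto
  qed
  moreover have "\<exists>M>0. \<forall>r\<ge>1. \<bar>U r - l\<bar> \<le> M * r powr e"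
    by (rule upper_bound_from_one[OF c(1) _ l M Ul]) (use n y in \<open>auto simp: e_def\<close>)
  ultimately show ?thesis using lim unfolding fast_def e_def by blast
qed

text \<open>As \<open>1 / p\<close> is small in mean over \<open>[r, 2 * r]\<close>, so is
  \<open>1 / W^2\<close>, and \<open>powr_ge_tangent\<close> bounds the mean of
  \<open>\<bar>W\<bar> powr q\<close> from below by \<open>m r powr q\<close>. The case
  \<open>q = 1\<close> bounds the increment of \<open>U\<close>; general \<open>q\<close> excludes
  integrability through dyadic intervals.\<close>

lemma slow_if_inverse_bounded:
  assumes bdd: "\<And>T. T \<ge> a \<Longrightarrow> integral {a..T} (\<lambda>r. 1 / p r) \<le> K"
  shows "\<exists>l. (U \<longlongrightarrow> l) at_top \<and> slow l"
proof -
  obtain \<sigma> l where \<sigma>: "\<sigma> = 1 \<or> \<sigma> = -1" and lim: "(U \<longlongrightarrow> l) at_top" and l: "\<bar>l\<bar> \<le> B"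
    and int: "\<And>r R. a \<le> r \<Longrightarrow> r \<le> R \<Longrightarrow> ((\<lambda>s. \<bar>W s\<bar>) has_integral \<sigma> * (U R - U r)) {r..R}"
    and le: "\<And>r. a \<le> r \<Longrightarrow> \<sigma> * U r \<le> \<sigma> * l"
    using monotone_limit by blast
  obtain C t where C: "C > 0" and t: "t \<ge> a"
    and inv: "\<And>r R. t \<le> r \<Longrightarrow> r < R \<Longrightarrow> integral {r..R} (\<lambda>s. 1 / p s) \<le> C * r powr (- 2 * y)"
    using stable_weight.inverse_decay_of_inverse_bounded[OF weight a p_pos bdd] unfolding y_def by blast
  \<comment> \<open>\<open>k\<close> and \<open>m\<close> are chosen so that the bound
    \<open>(2 * r) ^ n * (C * r powr (- 2 * y))\<close> for the integral of \<open>1 / W^2\<close>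
    over \<open>[r, 2 * r]\<close> equals \<open>r / (m r)^2\<close>. The integrated tangent then
    gives at least \<open>m r powr q\<close> times
    \<open>(1 + q / 2) * r - q / 2 * r = r\<close>.\<close>
  define k where "k = 1 / sqrt (2 ^ n * C)"
  have k: "k > 0" "k\<^sup>2 = 1 / (2 ^ n * C)" using C by (simp_all add: k_def power_divide)
  define m where "m r = k * r powr ((1 - real n) / 2 + y)" for r
  have m2: "(m r)\<^sup>2 * ((2 * r) ^ n * (C * r powr (- 2 * y))) = r" if r: "r > 0" for r
  proof -
    have m: "(m r)\<^sup>2 = k\<^sup>2 * r powr (1 - real n + 2 * y)"
      unfolding m_def power_mult_distrib using r by (simp add: power2_eq_square powr_add[symmetric])
    have "(2 * r) ^ n = 2 ^ n * r powr real n" using r by (simp add: power_mult_distrib powr_realpow)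
    then have "(m r)\<^sup>2 * ((2 * r) ^ n * (C * r powr (- 2 * y)))
        = (k\<^sup>2 * (2 ^ n * C)) * (r powr (1 - real n + 2 * y) * (r powr real n * r powr (- 2 * y)))"
      by (simp add: m mult_ac)
    also have "k\<^sup>2 * (2 ^ n * C) = 1" using C k(2) by simp
    also have "r powr (1 - real n + 2 * y) * (r powr real n * r powr (- 2 * y)) = r"
      using r by (simp add: powr_add[symmetric])
    finally show ?thesis by simp
  qed
  have low: "r * m r powr q \<le> integral {r..2 * r} (\<lambda>s. \<bar>W s\<bar> powr q)" if r: "r \<ge> t" and q: "q > 0" for r q
  proof -
    have r1: "r > 1" "a \<le> r" using r t a by auto
    have m: "m r > 0" using k r1 by (simp add: m_def)
    have iinv: "(\<lambda>s. 1 / p s) integrable_on {r..2 * r}"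
      using stable_weight.inverse_integrable[OF weight a p_pos r1(2)] .
    have "((\<lambda>s. m r powr q * ((1 + q / 2) - q / 2 * (m r)\<^sup>2 * ((2 * r) ^ n * (1 / p s)))) has_integral
        m r powr q * ((1 + q / 2) * r - q / 2 * (m r)\<^sup>2 * ((2 * r) ^ n * integral {r..2 * r} (\<lambda>s. 1 / p s)))) {r..2 * r}"
      using has_integral_const_real[of "1 + q / 2" r "2 * r"] r1 iinv
      by (intro has_integral_mult_right has_integral_diff integrable_integral) (auto simp: mult.commute)
    moreover have "((\<lambda>s. \<bar>W s\<bar> powr q) has_integral integral {r..2 * r} (\<lambda>s. \<bar>W s\<bar> powr q)) {r..2 * r}"
      using r1 by (intro integrable_integral integrable_continuous_interval abs_W_powr_cont') auto
    moreover have "m r powr q * ((1 + q / 2) - q / 2 * (m r)\<^sup>2 * ((2 * r) ^ n * (1 / p s))) \<le> \<bar>W s\<bar> powr q"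
      if s: "s \<in> {r..2 * r}" for s
    proof -
      have W: "W s \<noteq> 0" using s r1 W_nz by auto
      have "s ^ n \<le> (2 * r) ^ n" using s r1 by (intro power_mono) auto
      then have "1 / (W s)\<^sup>2 \<le> (2 * r) ^ n * (1 / p s)"
        using s r1 W by (simp add: field_simps)
      then have "q / 2 * (m r)\<^sup>2 * (1 / (W s)\<^sup>2) \<le> q / 2 * (m r)\<^sup>2 * ((2 * r) ^ n * (1 / p s))"
        using q by (intro mult_left_mono) auto
      then have "m r powr q * ((1 + q / 2) - q / 2 * (m r)\<^sup>2 * ((2 * r) ^ n * (1 / p s)))
          \<le> m r powr q * ((1 + q / 2) - q / 2 * (m r)\<^sup>2 / \<bar>W s\<bar>\<^sup>2)"
        by (intro mult_left_mono) auto
      also have "\<dots> \<le> \<bar>W s\<bar> powr q" using W m q by (intro powr_ge_tangent) auto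
      finally show ?thesis .
    qed
    ultimately have "m r powr q * ((1 + q / 2) * r
        - q / 2 * (m r)\<^sup>2 * ((2 * r) ^ n * integral {r..2 * r} (\<lambda>s. 1 / p s)))
        \<le> integral {r..2 * r} (\<lambda>s. \<bar>W s\<bar> powr q)" by (rule has_integral_le)
    moreover have "q / 2 * ((m r)\<^sup>2 * ((2 * r) ^ n * integral {r..2 * r} (\<lambda>s. 1 / p s))) \<le> q / 2 * r"
    proof -
      have "(m r)\<^sup>2 * ((2 * r) ^ n * integral {r..2 * r} (\<lambda>s. 1 / p s))
          \<le> (m r)\<^sup>2 * ((2 * r) ^ n * (C * r powr (- 2 * y)))"
        using inv[OF r, of "2 * r"] r1 by (intro mult_left_mono) auto
      then show ?thesis using m2[of r] r1 q by (intro mult_left_mono) auto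
    qed
    then have "m r powr q * r \<le> m r powr q * ((1 + q / 2) * r
        - q / 2 * (m r)\<^sup>2 * ((2 * r) ^ n * integral {r..2 * r} (\<lambda>s. 1 / p s)))"
      by (intro mult_left_mono) (auto simp: algebra_simps)
    ultimately show ?thesis by (simp add: mult.commute)
  qed
  have "k * r powr (3 / 2 - real n / 2 + y) \<le> \<bar>U r - l\<bar>" if r: "r \<ge> t" for r
  proof -
    have r1: "r > 1" "a \<le> r" using r t a by auto
    have m: "m r > 0" using k r1 by (simp add: m_def)
    have "k * r powr (3 / 2 - real n / 2 + y) = r powr 1 * m r"
      unfolding m_def using r1 by (simp only: mult.left_commute[of _ k] powr_add[symmetric]) (simp add: field_simps)
    also have "\<dots> = r * m r powr 1" using r1 m by simp
    also have "\<dots> \<le> integral {r..2 * r} (\<lambda>s. \<bar>W s\<bar> powr 1)" by (rule low[OF r]) simp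
    also have "\<dots> = \<sigma> * (U (2 * r) - U r)" using integral_unique[OF int[of r "2 * r"]] r1 by simp
    also have "\<dots> \<le> \<sigma> * (l - U r)" using le[of "2 * r"] r1 by (simp add: algebra_simps)
    also have "\<dots> \<le> \<bar>U r - l\<bar>" using \<sigma> by auto
    finally show ?thesis .
  qed
  moreover have "\<not> integrable lborel (\<lambda>r. r ^ n * (indicator {1<..} r * \<bar>W r\<bar> powr q))"
    if q: "q > 0" "q * (real n / 2 - 1 / 2 - y) \<le> real n + 1" for q
  proof (rule not_integrable_if_dyadic_lower_bound)
    show "k powr q > 0" using k by simp
    fix r assume r: "r \<ge> t"
    have r1: "r > 1" "a \<le> r" using r t a by auto
    have cont: "continuous_on {r..2 * r} (\<lambda>s. s ^ n * \<bar>W s\<bar> powr q)"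
      using abs_W_powr_cont[OF r1(2)] by (rule continuous_on_subset) auto
    \<comment> \<open>The condition on \<open>q\<close> says exactly that this exponent is
      nonnegative.\<close>
    have "1 \<le> r powr (real n + 1 + q * ((1 - real n) / 2 + y))"
      using r1 q by (intro ge_one_powr_ge_zero) (auto simp: field_simps)
    then have "k powr q * 1 \<le> k powr q * r powr (real n + 1 + q * ((1 - real n) / 2 + y))"
      by (intro mult_left_mono) auto
    also have "r powr (real n + 1 + q * ((1 - real n) / 2 + y))
        = r ^ n * r * r powr (q * ((1 - real n) / 2 + y))"
      unfolding powr_add[of r _ "q * _"] using r1 by (simp add: powr_add powr_realpow)
    also have "k powr q * (r ^ n * r * r powr (q * ((1 - real n) / 2 + y))) = r ^ n * (r * m r powr q)"
    proof -
      have "m r powr q = k powr q * r powr (q * ((1 - real n) / 2 + y))"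
        unfolding m_def using r1 k by (simp only: powr_mult powr_powr powr_ge_zero less_imp_le mult.commute[of q])
      then show ?thesis by (simp only: mult_ac)
    qed
    also have "\<dots> \<le> r ^ n * integral {r..2 * r} (\<lambda>s. \<bar>W s\<bar> powr q)"
      using low[OF r q(1)] r1 by (intro mult_left_mono) auto
    also have "\<dots> = integral {r..2 * r} (\<lambda>s. r ^ n * \<bar>W s\<bar> powr q)" by simp
    also have "\<dots> \<le> integral {r..2 * r} (\<lambda>s. s ^ n * \<bar>W s\<bar> powr q)"
      using r1 by (intro integral_le integrable_continuous_interval cont mult_right_mono power_mono
          continuous_on_mult continuous_on_const abs_W_powr_cont') auto
    also have "\<dots> = (LINT s:{r..2 * r}|lborel. s ^ n * \<bar>W s\<bar> powr q)"
      by (rule set_borel_integral_eq_integral(2)[symmetric]) (rule borel_integrable_atLeastAtMost'[OF cont])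
    also have "\<dots> = (LINT s:{r..2 * r}|lborel. s ^ n * (indicator {1<..} s * \<bar>W s\<bar> powr q))"
      using r1 by (intro set_lebesgue_integral_cong) auto
    finally show "k powr q \<le> (LINT s:{r..2 * r}|lborel. s ^ n * (indicator {1<..} s * \<bar>W s\<bar> powr q))"
      by simp
  qed
  ultimately show ?thesis
    unfolding slow_def using lim k(1) t a
    by (intro exI[of _ l] conjI exI[of _ k] exI[of _ t] allI impI) auto
qed

end

theorem fast_or_slow: "\<exists>l. (U \<longlongrightarrow> l) at_top \<and> (fast l \<or> slow l)"
proof -
  consider a where "a > 1" "\<And>r. r \<ge> a \<Longrightarrow> W r = 0" | a where "a > 1" "\<And>r. r \<ge> a \<Longrightarrow> W r \<noteq> 0"
    using eventually_zero_or_nonzero by blast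
  then show ?thesis
  proof cases
    case 1
    then show ?thesis using fast_if_eventually_zero by blast
  next
    case 2
    show ?thesis
    proof (cases "\<forall>K. \<exists>T>a. integral {a..T} (\<lambda>r. 1 / p r) > K")
      case True
      then show ?thesis using fast_if_inverse_unbounded[OF 2] by blast
    next
      case False
      then obtain K where K: "\<And>T. a < T \<Longrightarrow> integral {a..T} (\<lambda>r. 1 / p r) \<le> K"
        by (metis not_less)
      \<comment> \<open>At \<open>T = a\<close> the integral is 0, whence the maximum.\<close>
      have "integral {a..T} (\<lambda>r. 1 / p r) \<le> max K 0" if "T \<ge> a" for T
        using K[of T] that by (cases "T = a") auto
      then show ?thesis using slow_if_inverse_bounded[OF 2] by blast
    qed
  qed
qed

end

subsection \<open>The dichotomy for radial solutions\<close>

lemma gradient_in_Lp_radial: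
  fixes u :: "'a::euclidean_space \<Rightarrow> real"
  assumes u: "\<And>x::'a. x \<in> exterior \<Longrightarrow> u x = U (norm x)"
    and U: "\<And>r. r > 1 \<Longrightarrow> (U has_real_derivative W r) (at r)" and W: "continuous_on {1<..} W"
  shows "gradient_in_Lp (ereal q) u \<longleftrightarrow>
      integrable lborel (\<lambda>r. r ^ (DIM('a) - 1) * (indicator {1<..} r * \<bar>W r\<bar> powr q))"
    and "\<lbrakk>\<And>r. r > 1 \<Longrightarrow> \<bar>W r\<bar> \<le> B\<rbrakk> \<Longrightarrow> gradient_in_Lp \<infinity> u"
proof -
  let ?G = "\<lambda>x::'a. norm (gradient_on exterior u x)"
  have G: "?G x = \<bar>W (norm x)\<bar>" if "x \<in> exterior" for x
    using norm_gradient_radial[OF u that U] that by (simp add: exterior_def)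
  have S: "exterior \<in> sets (lebesgue :: 'a measure)"
    by (simp add: open_exterior borel_open sets_completionI_sets)
  have "continuous_on exterior (\<lambda>x::'a. \<bar>W (norm x)\<bar>)"
    by (intro continuous_intros continuous_on_compose2[OF W]) (auto simp: exterior_def)
  then have "continuous_on exterior ?G" by (rule continuous_on_eq) (simp add: G)
  then have meas: "?G \<in> borel_measurable (lebesgue_on exterior)"
    by (rule continuous_imp_measurable_on_sets_lebesgue[OF _ S])
  define h where "h r = indicator {1<..} r * \<bar>W r\<bar> powr q" for r
  have "(\<lambda>r. indicator {1<..} r *\<^sub>R W r) \<in> borel_measurable borel"
    by (intro borel_measurable_continuous_on_indicator W) auto
  then have "(\<lambda>r. indicator {1<..} r * \<bar>indicator {1<..} r *\<^sub>R W r\<bar> powr q) \<in> borel_measurable borel"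
    by measurable
  also have "(\<lambda>r. indicator {1<..} r * \<bar>indicator {1<..} r *\<^sub>R W r\<bar> powr q) = h"
    by (auto simp: h_def split: split_indicator)
  finally have [measurable]: "h \<in> borel_measurable borel" .
  have "gradient_in_Lp (ereal q) u \<longleftrightarrow> integrable (lebesgue_on exterior) (\<lambda>x. ?G x powr q)"
    using meas by (simp add: in_Lp_def)
  also have "\<dots> \<longleftrightarrow> integrable lebesgue (\<lambda>x. indicator exterior x *\<^sub>R (?G x powr q))"
    using S by (subst integrable_restrict_space) auto
  also have "(\<lambda>x. indicator exterior x *\<^sub>R (?G x powr q)) = (\<lambda>x. h (norm x))"
    using G by (auto simp: h_def exterior_def split: split_indicator)
  also have "integrable lebesgue (\<lambda>x::'a. h (norm x)) \<longleftrightarrow> integrable lborel (\<lambda>x::'a. h (norm x))"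
    by (intro integrable_completion) measurable
  also have "\<dots> \<longleftrightarrow> integrable lborel (\<lambda>r. r ^ (DIM('a) - 1) * h r)"
    by (intro radial_integral_eq(2)) (measurable, simp add: h_def)
  finally show "gradient_in_Lp (ereal q) u \<longleftrightarrow>
      integrable lborel (\<lambda>r. r ^ (DIM('a) - 1) * (indicator {1<..} r * \<bar>W r\<bar> powr q))"
    by (simp add: h_def)
  assume "\<And>r. r > 1 \<Longrightarrow> \<bar>W r\<bar> \<le> B"
  then have "AE x in lebesgue_on exterior. \<bar>?G x\<bar> \<le> B"
    using G by (intro AE_I2) (auto simp: exterior_def)
  with meas show "gradient_in_Lp \<infinity> u" by (auto simp: in_Lp_def)
qed

text \<open>Regularity of \<open>f\<close> enters twice: its derivative allows the equation to be
  differentiated, and its boundedness on the range of \<open>u\<close> bounds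
  \<open>V + n / r * W\<close> and thereby \<open>W\<close>.\<close>

lemma stable_radial_profile:
  fixes u :: "'a::euclidean_space \<Rightarrow> real"
  assumes dim: "DIM('a) \<ge> 3" and f: "f C1_differentiable_on UNIV"
    and sol: "exterior_solution f u" and stable: "exterior_stable f u"
    and bdd: "bounded (u ` closed_exterior)" and u: "\<forall>x\<in>closed_exterior. u x = U (norm x)"
  obtains W V B where "radial_profile U W V (DIM('a) - 1) B"
proof -
  define n where "n = DIM('a) - 1"
  have n: "n \<ge> 2" and nN: "real n = real DIM('a) - 1" using dim by (simp_all add: n_def of_nat_diff)
  obtain W V where U: "\<And>r. r > 1 \<Longrightarrow> (U has_real_derivative W r) (at r)"
    and W: "\<And>r. r > 1 \<Longrightarrow> (W has_real_derivative V r) (at r)"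
    and ode: "\<And>r. r > 1 \<Longrightarrow> V r + real n / r * W r = - f (U r)"
    by (rule radial_solution_ode[OF sol u]) (use nN in auto)
  obtain D where D: "\<And>x. (f has_vector_derivative D x) (at x)" and contD: "continuous_on UNIV D"
    using f by (auto simp: C1_differentiable_on_def)
  have f': "(f has_real_derivative D x) (at x)" for x
    using D by (simp add: has_real_derivative_iff_has_vector_derivative)
  have deriv: "deriv f = D" using DERIV_imp_deriv[OF f'] by blast
  have fcont: "continuous_on S f" for S
    using f' by (intro DERIV_continuous_on[of _ f D]) (simp add: has_field_derivative_at_within)
  have contU: "continuous_on {1<..} U" and contW: "continuous_on {1<..} W"
    using DERIV_continuous_on_greaterThan U W by blast+
  obtain e :: 'a where e: "norm e = 1" using vector_choose_size zero_le_one by blast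
  obtain B0 where B0: "\<And>x. x \<in> closed_exterior \<Longrightarrow> \<bar>u x\<bar> \<le> B0"
    using bdd by (auto simp: bounded_iff)
  have UB: "\<bar>U r\<bar> \<le> B0" if "r \<ge> 1" for r
    using B0[of "r *\<^sub>R e"] u that e by (auto simp: closed_exterior_def)
  have "bounded (f ` {-B0..B0})"
    by (intro compact_imp_bounded compact_continuous_image fcont) auto
  then obtain K where "\<forall>x\<in>f ` {-B0..B0}. norm x \<le> K" unfolding bounded_iff by blast
  then have K: "\<bar>f x\<bar> \<le> K" if "x \<in> {-B0..B0}" for x using that by auto
  have WB: "\<bar>W r\<bar> \<le> 2 ^ n * (2 * B0) + 2 ^ n * K" if r: "r > 1" for r
    using U W _ _ r
  proof (rule bounded_derivative)
    show "\<bar>V t + real n / t * W t\<bar> \<le> K" if "t > 1" for t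
      using K[of "U t"] UB[of t] ode[OF that] that by (simp add: abs_le_iff)
  qed (auto intro: UB)
  have Vcont: "continuous_on {1<..} V"
  proof -
    have "continuous_on {1<..} (\<lambda>r. - f (U r) - real n / r * W r)"
      by (intro continuous_intros continuous_on_compose2[OF fcont[of UNIV] contU] contW) auto
    then show ?thesis
    proof (rule continuous_on_eq)
      show "- f (U r) - real n / r * W r = V r" if "r \<in> {1<..}" for r
        using ode[of r] that by simp
    qed
  qed
  let ?p = "\<lambda>r. r ^ n * (W r)\<^sup>2"
  have smooth: "0 \<le> integral {a..b} (\<lambda>r. ?p r * (z' r)\<^sup>2 - real n * ?p r / r\<^sup>2 * (z r)\<^sup>2)"
    if "1 < a" "a < b" "\<And>r. r > 1 \<Longrightarrow> (z has_real_derivative z' r) (at r)" "continuous_on {1<..} z'"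
      "\<And>r. r \<notin> {a<..<b} \<Longrightarrow> z r = 0" for z z' a b
  proof (rule stable_weighted[OF _ f' contD U W ode that(3,4,1,2,5)])
    fix \<eta> \<eta>' assume "\<And>r. r > 1 \<Longrightarrow> (\<eta> has_real_derivative \<eta>' r) (at r)" "continuous_on {1<..} \<eta>'"
      "\<And>r. r \<notin> {a<..<b} \<Longrightarrow> \<eta> r = 0"
    from stable_radial[OF stable u _ contU this(1,2) that(1,2) this(3)] contD
    show "0 \<le> integral {a..b} (\<lambda>r. r ^ n * ((\<eta>' r)\<^sup>2 - D (U r) * (\<eta> r)\<^sup>2))"
      by (simp add: deriv n_def)
  qed
  have contp: "continuous_on {1<..} ?p" "continuous_on {1<..} (\<lambda>r. real n * ?p r / r\<^sup>2)"
    by (intro continuous_intros contW; auto)+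
  have "stable_weight ?p (real n)"
  proof
    fix a b e :: real assume ab: "1 < a" "a < b" and "energy_le ?p (real n) a b 0 0 e"
    then obtain z g S L e' where z: "continuous_on {a..b} z" "z a = 0" "z b = 0" "finite S" "0 \<le> L"
      "\<And>r. r \<in> {a<..<b} - S \<Longrightarrow> (z has_real_derivative g r) (at r)"
      "\<And>r. r \<in> {a<..<b} - S \<Longrightarrow> \<bar>g r\<bar> \<le> L"
      "((\<lambda>r. ?p r * (g r)\<^sup>2 - real n * ?p r / r\<^sup>2 * (z r)\<^sup>2) has_integral e') {a..b}" "e' \<le> e"
      unfolding energy_le_def by blast
    \<comment> \<open>The functions behind \<open>energy_le\<close> are only piecewise
      differentiable, so the inequality for smooth \<open>z\<close> is extended by
      regularization.\<close>
    have "0 \<le> e'"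
      by (rule nonneg_form_lipschitz[OF smooth contp ab z(1-4,6,5,7,8)])
    with z(9) show "0 \<le> e" by simp
  qed (use contp n in auto)
  moreover define B where "B = max B0 (2 ^ n * (2 * B0) + 2 ^ n * K)"
  have "\<bar>U r\<bar> \<le> B" if "r \<ge> 1" for r using UB[OF that] by (simp add: B_def)
  moreover have "\<bar>W r\<bar> \<le> B" if "r > 1" for r using WB[OF that] by (simp add: B_def)
  ultimately have "radial_profile U W V n B"
    using U W Vcont n by (intro radial_profile.intro)
  then show ?thesis using that by (simp add: n_def)
qed

text \<open>Squaring \<open>sqrt (N - 1) < N / 2 - 2\<close> gives
  \<open>(N - 2) * (N - 10) > 0\<close>, and \<open>N > 4\<close> rules out the lower
  branch.\<close>

lemma neg_exponent_imp_dim: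
  fixes N :: nat
  assumes "N \<ge> 1" "- real N / 2 + sqrt (real N - 1) + 2 < 0"
  shows "N \<ge> 11"
proof -
  define s where "s = sqrt (real N - 1)"
  have s: "s \<ge> 0" "s\<^sup>2 = real N - 1" using assms by (simp_all add: s_def)
  have lt: "s < real N / 2 - 2" using assms(2) by (simp add: s_def)
  have "s\<^sup>2 < (real N / 2 - 2)\<^sup>2" using lt s(1) by (intro power_strict_mono) auto
  then have "0 < (real N - 2) * (real N - 10)"
    unfolding s(2) by (simp add: power2_eq_square field_simps)
  moreover have "real N > 4" using lt s(1) by simp
  ultimately have "real N > 10" by (simp add: zero_less_mult_iff)
  then show ?thesis by simp
qed

theorem theorem1p2:
  fixes u :: "real ^ 'n \<Rightarrow> real" and f U :: "real \<Rightarrow> real"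
  assumes "CARD('n) \<ge> 3"
    and "f C1_differentiable_on UNIV"
    and "exterior_solution f u"
    and "exterior_stable f u"
    and "bounded (u ` closed_exterior)"
    and "\<forall>x\<in>closed_exterior. u x = U (norm x)"
  shows "\<exists>u_inf. (U \<longlongrightarrow> u_inf) at_top \<and>
    (slow_decay u U u_inf \<or> fast_decay u U u_inf) \<and>
    \<not> (slow_decay u U u_inf \<and> fast_decay u U u_inf)"
proof -
  define N where "N = real CARD('n)"
  have N: "N \<ge> 3" using assms(1) by (simp add: N_def)
  obtain W V B where rp: "radial_profile U W V (DIM(real^'n) - 1) B"
    by (rule stable_radial_profile[OF _ assms(2-6)]) (use assms(1) in auto)
  define k where "k = CARD('n) - 1"
  from rp interpret radial_profile U W V k B by (simp add: k_def)
  have nN: "real k = N - 1" using assms(1) by (simp add: k_def N_def of_nat_diff)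
  have y_eq: "y = sqrt (N - 1)" by (simp add: y_def nN)
  have u: "u x = U (norm x)" if "x \<in> exterior" for x
    using assms(6) that exterior_subset_closed by blast
  have Lp: "gradient_in_Lp (ereal q) u \<longleftrightarrow>
      integrable lborel (\<lambda>r. r ^ k * (indicator {1<..} r * \<bar>W r\<bar> powr q))" for q
    using gradient_in_Lp_radial(1)[OF u dU W_cont] by (simp add: k_def)
  have Linf: "gradient_in_Lp \<infinity> u"
    by (rule gradient_in_Lp_radial(2)[OF u dU W_cont W_bdd])
  obtain l where lim: "(U \<longlongrightarrow> l) at_top" and "fast l \<or> slow l" using fast_or_slow by blast
  then consider "fast l" | "slow l" by blast
  then have "slow_decay u U l \<or> fast_decay u U l"
  proof cases
    case 1
    have pos: "N / 2 + sqrt (N - 1) - 1 > 0" using N y(1) unfolding y_eq by linarith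
    have fin: "gradient_in_Lp (ereal q) u" if "N / (N / 2 + sqrt (N - 1) - 1) < q" for q
    proof -
      have "0 < N / (N / 2 + sqrt (N - 1) - 1)" using pos N by simp
      then have "q > 0" using that by linarith
      have "N < q * (N / 2 + sqrt (N - 1) - 1)" using that pos by (simp add: divide_less_eq)
      also have "N / 2 + sqrt (N - 1) - 1 = real k / 2 - 1 / 2 + y" by (simp add: nN y_eq field_simps)
      finally have "real k + 1 < q * (real k / 2 - 1 / 2 + y)" unfolding nN by simp
      with \<open>q > 0\<close> 1 show ?thesis unfolding Lp fast_def by blast
    qed
    \<comment> \<open>Finite exponents come from \<open>fast\<close> and the exponent infinity from
      the bound on \<open>W\<close>; minus infinity violates the strict lower bound.\<close>
    have "gradient_in_Lp p u" if "ereal (N / (N / 2 + sqrt (N - 1) - 1)) < p" for p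
      using that fin Linf by (cases p) auto
    moreover have "gradient_in_Lp 2 u"
    proof -
      \<comment> \<open>The exponent 2 lies above the critical one exactly because
        \<open>y > 1\<close>.\<close>
      have "N / (N / 2 + sqrt (N - 1) - 1) < 2" using pos y(1) unfolding y_eq by (simp add: divide_less_eq)
      from fin[OF this] show ?thesis by simp
    qed
    moreover have "\<exists>M>0. \<forall>r\<ge>1. \<bar>U r - l\<bar> \<le> M * r powr (- N / 2 - sqrt (N - 1) + 2)"
    proof -
      have "3 / 2 - (N - 1) / 2 - sqrt (N - 1) = - N / 2 - sqrt (N - 1) + 2" by (simp add: field_simps)
      with 1 show ?thesis by (simp add: fast_def nN y_eq)
    qed
    ultimately show ?thesis unfolding fast_decay_def Let_def N_def[symmetric] by blast
  next
    case 2
    have "3 / 2 - (N - 1) / 2 + sqrt (N - 1) = - N / 2 + sqrt (N - 1) + 2" by (simp add: field_simps)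
    with 2 obtain M r0 where M: "M > 0" and r0: "r0 \<ge> 1"
      and low: "\<And>r. r \<ge> r0 \<Longrightarrow> M * r powr (- N / 2 + sqrt (N - 1) + 2) \<le> \<bar>U r - l\<bar>"
      by (auto simp: slow_def nN y_eq)
    \<comment> \<open>A nonnegative exponent would keep \<open>\<bar>U r - l\<bar>\<close> above
      \<open>M\<close>, against the convergence to \<open>l\<close>. This is what forces the
      dimension to be at least 11.\<close>
    have "- N / 2 + sqrt (N - 1) + 2 < 0"
    proof (rule ccontr)
      assume "\<not> ?thesis"
      then have ge: "1 \<le> r powr (- N / 2 + sqrt (N - 1) + 2)" if "r \<ge> r0" for r
        using that r0 by (intro ge_one_powr_ge_zero) auto
      have "M \<le> \<bar>U r - l\<bar>" if "r \<ge> r0" for r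
        using low[OF that] M mult_left_mono[OF ge[OF that], of M] by linarith
      then have "\<forall>\<^sub>F r in at_top. M \<le> \<bar>U r - l\<bar>"
        by (rule eventually_mono[OF eventually_ge_at_top])
      moreover have "((\<lambda>r. \<bar>U r - l\<bar>) \<longlongrightarrow> \<bar>l - l\<bar>) at_top" using lim by (intro tendsto_intros)
      ultimately have "M \<le> \<bar>l - l\<bar>" by (intro tendsto_lowerbound[where F = at_top]) auto
      with M show False by simp
    qed
    then have "CARD('n) \<ge> 11" by (intro neg_exponent_imp_dim) (auto simp: N_def)
    have pos: "N / 2 - sqrt (N - 1) - 1 > 0" using \<open>- N / 2 + sqrt (N - 1) + 2 < 0\<close> by simp
    have notin: "\<not> gradient_in_Lp (ereal q) u" if "1 \<le> q" "q \<le> N / (N / 2 - sqrt (N - 1) - 1)" for q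
    proof -
      have "N / 2 - sqrt (N - 1) - 1 = real k / 2 - 1 / 2 - y" by (simp add: nN y_eq field_simps)
      moreover have "q * (N / 2 - sqrt (N - 1) - 1) \<le> N" using that(2) pos by (simp add: le_divide_eq)
      ultimately have "q * (real k / 2 - 1 / 2 - y) \<le> real k + 1" unfolding nN by simp
      moreover have "q > 0" using that(1) by simp
      ultimately show ?thesis using 2 unfolding Lp slow_def by blast
    qed
    have "2 * (N / 2 - sqrt (N - 1) - 1) \<le> N"
      unfolding y_eq[symmetric] using y(1) by (simp add: algebra_simps)
    then have "2 \<le> N / (N / 2 - sqrt (N - 1) - 1)" using pos by (simp only: le_divide_eq if_True)
    from notin[OF _ this] have "\<not> gradient_in_Lp 2 u" by simp
    then show ?thesis
      unfolding slow_decay_def Let_def N_def[symmetric]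
      using \<open>CARD('n) \<ge> 11\<close> M r0 low notin by blast
  qed
  \<comment> \<open>The alternatives disagree on whether the gradient is square integrable.\<close>
  moreover have "\<not> (slow_decay u U l \<and> fast_decay u U l)"
    by (auto simp: slow_decay_def fast_decay_def Let_def)
  ultimately show ?thesis using lim by blast
qed

end
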